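(* There is a number $N$ such that any element of the Grigorchuk group $\Gamma$ belonging to the commutator subgroup $[\Gamma,\Gamma]$ is a product of at most $N$ commutators of elements of $\Gamma$.
   Context: The Grigorchuk group. Let $\mathcal{T}$ be the infinite rooted regular binary tree with vertex set $\{0,1\}^*$ (finite binary words, root the empty word). $\Gamma\le \mathrm{Aut}(\mathcal{T})$ is the group generated by the automorphisms $a,b,c,d$ defined (recursively) for all $w\in\{0,1\}^*$ by $a(0w)=1w$, $a(1w)=0w$; $b(0w)=0a(w)$, $b(1w)=1c(w)$; $c(0w)=0a(w)$, $c(1w)=1d(w)$; $d(0w)=0w$, $d(1w)=1b(w)$ (each fixes the root). *)

theory Defs
  imports "HOL-Algebra.Generated_Groups"
begin

text \<open>Vertices of the rooted binary tree are the finite words over \<open>{0,1}\<close>, encoded as lists of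
  booleans (\<open>False\<close> is the letter 0, \<open>True\<close> is the letter 1). The root is the empty word, and
  \<open>u\<close>, \<open>v\<close> are joined by an edge iff one is obtained from the other by appending a letter.\<close>

definition tree_edge :: "bool list \<Rightarrow> bool list \<Rightarrow> bool" where
  "tree_edge u v \<longleftrightarrow> (\<exists>x. v = u @ [x] \<or> u = v @ [x])"

definition tree_Aut :: "(bool list \<Rightarrow> bool list) monoid" where
  "tree_Aut = \<lparr>carrier = {f. bij f \<and> f [] = [] \<and> (\<forall>u v. tree_edge (f u) (f v) \<longleftrightarrow> tree_edge u v)},
     monoid.mult = (\<circ>), one = id\<rparr>"

fun grig_a :: "bool list \<Rightarrow> bool list" where
  "grig_a [] = []"
| "grig_a (False # w) = True # w"
| "grig_a (True # w) = False # w"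

fun grig_b grig_c grig_d :: "bool list \<Rightarrow> bool list" where
  "grig_b [] = []"
| "grig_b (False # w) = False # grig_a w"
| "grig_b (True # w) = True # grig_c w"
| "grig_c [] = []"
| "grig_c (False # w) = False # grig_a w"
| "grig_c (True # w) = True # grig_d w"
| "grig_d [] = []"
| "grig_d (False # w) = False # w"
| "grig_d (True # w) = True # grig_b w"

definition Grigorchuk_group :: "(bool list \<Rightarrow> bool list) monoid" where
  "Grigorchuk_group = subgroup_generated tree_Aut {grig_a, grig_b, grig_c, grig_d}"

text \<open>Since \<open>subgroup_generated G S\<close> silently discards the elements of \<open>S\<close> outside \<open>carrier G\<close>,
  we check below that the four generators are automorphisms of the tree.\<close>

lemma group_tree_Aut: "group tree_Aut"
proof (rule groupI)
  fix f assume "f \<in> carrier tree_Aut"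
  then have f: "bij f" "f [] = []" "\<And>u v. tree_edge (f u) (f v) \<longleftrightarrow> tree_edge u v"
    by (auto simp: tree_Aut_def)
  have "inv_into UNIV f \<in> carrier tree_Aut"
  proof -
    let ?g = "inv_into UNIV f"
    have fg: "f (?g x) = x" for x
      using f(1) by (simp add: bij_is_surj surj_f_inv_f)
    have "?g [] = []"
      using f(1,2) by (metis bij_is_inj inv_f_f)
    moreover have "tree_edge (?g u) (?g v) \<longleftrightarrow> tree_edge u v" for u v
      using f(3)[of "?g u" "?g v"] by (simp add: fg)
    ultimately show ?thesis
      using bij_imp_bij_inv[OF f(1)] by (simp add: tree_Aut_def)
  qed
  moreover have "inv_into UNIV f \<circ> f = id"
    using f(1) by (simp add: bij_is_inj)
  ultimately show "\<exists>g\<in>carrier tree_Aut. g \<otimes>\<^bsub>tree_Aut\<^esub> f = \<one>\<^bsub>tree_Aut\<^esub>"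
    by (intro bexI[of _ "inv_into UNIV f"]) (auto simp: tree_Aut_def)
qed (auto simp: tree_Aut_def bij_comp fun.map_comp)

lemma tree_Aut_involutionI:
  assumes inv: "\<And>w. f (f w) = w" and root: "f [] = []"
    and child: "\<And>w x. \<exists>y. f (w @ [x]) = f w @ [y]"
  shows "f \<in> carrier tree_Aut"
proof -
  have *: "tree_edge (f u) (f v)" if "tree_edge u v" for u v
  proof -
    from that obtain x where "v = u @ [x] \<or> u = v @ [x]"
      by (auto simp: tree_edge_def)
    then show ?thesis
      using child[of u x] child[of v x] by (auto simp: tree_edge_def)
  qed
  have "bij f" using inv by (rule involuntory_imp_bij)
  moreover have "tree_edge (f u) (f v) \<longleftrightarrow> tree_edge u v" for u v
    using *[of u v] *[of "f u" "f v"] inv by auto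
  ultimately show ?thesis using root by (simp add: tree_Aut_def)
qed

lemma grig_invol:
  "grig_a (grig_a w) = w"
  "grig_b (grig_b w) = w" "grig_c (grig_c w) = w" "grig_d (grig_d w) = w"
proof -
  show a: "grig_a (grig_a w) = w" for w by (cases w rule: grig_a.cases) auto
  show "grig_b (grig_b w) = w" "grig_c (grig_c w) = w" "grig_d (grig_d w) = w"
    by (induction w and w and w rule: grig_b_grig_c_grig_d.induct) (auto simp: a)
qed

lemma grig_snoc:
  "\<exists>y. grig_a (w @ [x]) = grig_a w @ [y]"
  "\<exists>y. grig_b (w @ [x]) = grig_b w @ [y]"
  "\<exists>y. grig_c (w @ [x]) = grig_c w @ [y]"
  "\<exists>y. grig_d (w @ [x]) = grig_d w @ [y]"
proof -
  show a: "\<exists>y. grig_a (w @ [x]) = grig_a w @ [y]" for w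
    by (cases w rule: grig_a.cases; cases x) auto
  have "length (grig_b [x]) = 1" "length (grig_c [x]) = 1" "length (grig_d [x]) = 1"
    by (induction x) simp_all
  then have base: "\<exists>y. grig_b [x] = [y]" "\<exists>y. grig_c [x] = [y]" "\<exists>y. grig_d [x] = [y]"
    by (auto simp: length_Suc_conv)
  show "\<exists>y. grig_b (w @ [x]) = grig_b w @ [y]"
    "\<exists>y. grig_c (w @ [x]) = grig_c w @ [y]"
    "\<exists>y. grig_d (w @ [x]) = grig_d w @ [y]"
    by (induction w and w and w rule: grig_b_grig_c_grig_d.induct) (simp_all add: a base)
qed

lemma grig_gens_in_tree_Aut: "{grig_a, grig_b, grig_c, grig_d} \<subseteq> carrier tree_Aut"
  using grig_invol grig_snoc by (auto intro!: tree_Aut_involutionI)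

lemma group_Grigorchuk_group: "group Grigorchuk_group"
  unfolding Grigorchuk_group_def
  by (rule group.group_subgroup_generated[OF group_tree_Aut])

end

theory Submission
  imports Defs Complex_Main
begin

text \<open>
  Write \<open>(u, v)\<close> for the tree automorphism acting as \<open>u\<close> below the vertex \<open>0\<close> and as \<open>v\<close> below
  the vertex \<open>1\<close>. Let \<open>K\<close> be the normal closure of \<open>(ab)\<^sup>2\<close> in \<open>\<Gamma>\<close>; it satisfies \<open>K \<times> K \<subseteq> K\<close>, and
  \<open>N = [\<Gamma>, K]\<close> has finite index in \<open>\<Gamma>\<close>. It is therefore enough to bound the number of commutators
  \<open>[g, k]\<close>, with \<open>g\<close> in \<open>\<Gamma>\<close> and \<open>k\<close> in \<open>K\<close>, whose product is a given element of \<open>N\<close>.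

  The proof separates two kinds of commutators. Those with both entries in \<open>K\<close> can be done in both
  subtrees at once, since \<open>([x, y], [z, w]) = [(x, z), (y, w)]\<close>. Those of the form \<open>[g, k]\<close> can be
  collected: modulo commutators of \<open>K\<close>, the value \<open>[g, k]\<close> depends only on the coset \<open>g K\<close> and
  is multiplicative in \<open>k\<close>. So if \<open>t\<^sub>1, \<dots>, t\<^sub>L\<close> represent the finitely many cosets of \<open>K\<close>, every element of
  \<open>N\<close> has the form \<open>[t\<^sub>1, k\<^sub>1] \<dots> [t\<^sub>L, k\<^sub>L] v\<close>, where \<open>v\<close> is a product of some number \<open>m\<close> of commutators of
  \<open>K\<close>, and multiplying by a further \<open>[g, k]\<close> raises \<open>m\<close> by at most \<open>L + 1\<close> (\<open>collected_absorb\<close>).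

  Now let \<open>y\<^sub>0\<close> and \<open>y\<^sub>1\<close> lie in \<open>N\<close>, and suppose that the product \<open>y\<^sub>0 y\<^sub>1\<close> has such a form with
  parameter \<open>2m\<close>. Since \<open>[a, (k, 1)] = (k\<^sup>-\<^sup>1, k)\<close>, one commutator moves any element of \<open>K\<close> from one
  subtree to the other; using it to split \<open>v\<close> into halves, one for each subtree, gives \<open>(y\<^sub>0, y\<^sub>1)\<close> the
  same form with parameter \<open>m + (L + 1)\<^sup>2\<close> (\<open>collected_pr\<close>). Passing from \<open>(y\<^sub>0, y\<^sub>1)\<close> to \<open>y\<^sub>0 y\<^sub>1\<close> also shortens:
  for a suitable weighted word length the sum of the lengths of the two sections of \<open>g\<close> is at most
  \<open>5/6\<close> of the length of \<open>g\<close> plus a constant (\<open>grig_contraction\<close>). Induction on the length reduces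
  everything to the finitely many short elements of \<open>N\<close>, and because the parameter is halved at each
  step before a constant is added, a single value of it serves for all of \<open>N\<close>
  (\<open>N_uniformly_collected\<close>).
\<close>

section \<open>Commutators and products of boundedly many factors\<close>

primrec prods :: "('a, 'b) monoid_scheme \<Rightarrow> 'a set \<Rightarrow> nat \<Rightarrow> 'a set" where
  "prods G A 0 = {\<one>\<^bsub>G\<^esub>}"
| "prods G A (Suc n) = {x \<otimes>\<^bsub>G\<^esub> y | x y. x \<in> A \<and> y \<in> prods G A n}"

lemma prods_foldr:
  assumes "x \<in> prods G A n"
  shows "\<exists>cs. length cs = n \<and> set cs \<subseteq> A \<and> x = foldr (\<otimes>\<^bsub>G\<^esub>) cs \<one>\<^bsub>G\<^esub>"
  using assms
proof (induction n arbitrary: x)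
  case (Suc n)
  then obtain y z where yz: "x = y \<otimes>\<^bsub>G\<^esub> z" "y \<in> A" "z \<in> prods G A n"
    by auto
  then obtain cs where "length cs = n" "set cs \<subseteq> A" "z = foldr (\<otimes>\<^bsub>G\<^esub>) cs \<one>\<^bsub>G\<^esub>"
    using Suc.IH by blast
  then show ?case
    using yz by (intro exI[of _ "y # cs"]) auto
qed simp

lemma prods_mono: "A \<subseteq> B \<Longrightarrow> prods G A n \<subseteq> prods G B n"
  by (induction n) auto

text \<open>This is how finitely many coset representatives, or the finitely many
  short elements, are covered by one common number of factors.\<close>

lemma finite_uniform_bound:
  assumes "finite F" and "\<And>x. x \<in> F \<Longrightarrow> \<exists>m::nat. P x m"
    and mono: "\<And>x m n. P x m \<Longrightarrow> m \<le> n \<Longrightarrow> P x n"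
  shows "\<exists>m. \<forall>x\<in>F. P x m"
proof -
  obtain f where f: "P x (f x)" if "x \<in> F" for x
    using assms(2) by metis
  have "P x (Max (f ` F))" if "x \<in> F" for x
    using mono[OF f[OF that]] that assms(1) by simp
  then show ?thesis by blast
qed

context group
begin

definition comm :: "'a \<Rightarrow> 'a \<Rightarrow> 'a" where
  "comm x y = x \<otimes> y \<otimes> inv x \<otimes> inv y"

lemma cancel_left:
  assumes "x \<in> carrier G" "y \<in> carrier G"
  shows "x \<otimes> (inv x \<otimes> y) = y" "inv x \<otimes> (x \<otimes> y) = y"
  using assms by (simp_all flip: m_assoc)

text \<open>Together these rewrite a product of group elements and inverses to a freely reduced word, so that
  identities valid in every group are proved by simplification alone.\<close>

lemmas group_normalize = comm_def m_assoc inv_mult_group cancel_left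

lemma comm_closed [simp, intro]:
  "x \<in> carrier G \<Longrightarrow> y \<in> carrier G \<Longrightarrow> comm x y \<in> carrier G"
  by (simp add: comm_def)

lemma comm_one [simp]: "x \<in> carrier G \<Longrightarrow> comm x \<one> = \<one>"
  by (simp add: comm_def)

lemma conj_mult:
  assumes "g \<in> carrier G" "x \<in> carrier G" "y \<in> carrier G"
  shows "g \<otimes> (x \<otimes> y) \<otimes> inv g = (g \<otimes> x \<otimes> inv g) \<otimes> (g \<otimes> y \<otimes> inv g)"
  using assms by (simp add: group_normalize)

lemma comm_conj:
  assumes "g \<in> carrier G" "x \<in> carrier G" "y \<in> carrier G"
  shows "g \<otimes> comm x y \<otimes> inv g = comm (g \<otimes> x \<otimes> inv g) (g \<otimes> y \<otimes> inv g)"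
  using assms by (simp add: group_normalize)

lemma comm_inverse:
  assumes "x \<in> carrier G" "y \<in> carrier G"
  shows "inv (comm x y) = comm (inv x) (x \<otimes> y \<otimes> inv x)"
  using assms by (simp add: group_normalize)

lemma prods_carrier: "A \<subseteq> carrier G \<Longrightarrow> prods G A n \<subseteq> carrier G"
  by (induction n) auto

lemma prods_one: "\<one> \<in> A \<Longrightarrow> \<one> \<in> prods G A n"
proof (induction n)
  case (Suc n)
  then show ?case by (auto intro!: exI[of _ \<one>])
qed simp

lemma prods_single: "A \<subseteq> carrier G \<Longrightarrow> x \<in> A \<Longrightarrow> x \<in> prods G A (Suc 0)"
  by (auto intro!: exI[of _ x])

lemma prods_mult:
  assumes "A \<subseteq> carrier G" "x \<in> prods G A m" "y \<in> prods G A n"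
  shows "x \<otimes> y \<in> prods G A (m + n)"
  using assms(2)
proof (induction m arbitrary: x)
  case 0
  moreover have "y \<in> carrier G" using assms(3) prods_carrier[OF assms(1)] by blast
  ultimately show ?case using assms(3) by simp
next
  case (Suc m)
  then obtain u v where uv: "x = u \<otimes> v" "u \<in> A" "v \<in> prods G A m"
    by auto
  then have "x \<otimes> y = u \<otimes> (v \<otimes> y)"
    using assms(1,3) prods_carrier[OF assms(1)] by (auto intro!: m_assoc)
  then show ?case using Suc.IH[OF uv(3)] uv(2) by auto
qed

text \<open>Products of exactly \<open>n\<close> factors behave like products of at most \<open>n\<close> factors as soon as the unit is
  an admissible factor.\<close>

lemma prods_le:
  assumes "A \<subseteq> carrier G" "\<one> \<in> A" "m \<le> n" "x \<in> prods G A m"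
  shows "x \<in> prods G A n"
proof -
  have "\<one> \<otimes> x \<in> prods G A (n - m + m)"
    using assms by (intro prods_mult prods_one) auto
  then show ?thesis
    using assms(3,4) prods_carrier[OF assms(1), of m] by auto
qed

lemma prods_split:
  assumes "A \<subseteq> carrier G" "x \<in> prods G A (m + n)"
  shows "\<exists>u\<in>prods G A m. \<exists>v\<in>prods G A n. x = u \<otimes> v"
  using assms(2)
proof (induction m arbitrary: x)
  case 0
  moreover from this have "x \<in> carrier G" using prods_carrier[OF assms(1)] by auto
  ultimately show ?case by (auto intro!: bexI[of _ x])
next
  case (Suc m)
  then obtain y z where yz: "x = y \<otimes> z" "y \<in> A" "z \<in> prods G A (m + n)"
    by auto
  then obtain u v where uv: "u \<in> prods G A m" "v \<in> prods G A n" "z = u \<otimes> v"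
    using Suc.IH by blast
  have "x = (y \<otimes> u) \<otimes> v"
    using yz uv assms(1) prods_carrier[OF assms(1)] by (auto intro!: m_assoc[symmetric])
  then show ?case using yz(2) uv(1,2) by auto
qed

lemma prods_conj:
  assumes "A \<subseteq> carrier G" "g \<in> carrier G" "\<And>x. x \<in> A \<Longrightarrow> g \<otimes> x \<otimes> inv g \<in> A"
    and "x \<in> prods G A n"
  shows "g \<otimes> x \<otimes> inv g \<in> prods G A n"
  using assms(4)
proof (induction n arbitrary: x)
  case 0
  then show ?case using assms(2) by simp
next
  case (Suc n)
  then obtain y z where yz: "x = y \<otimes> z" "y \<in> A" "z \<in> prods G A n"
    by auto
  then have "g \<otimes> x \<otimes> inv g = (g \<otimes> y \<otimes> inv g) \<otimes> (g \<otimes> z \<otimes> inv g)"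
    using assms(1,2) prods_carrier[OF assms(1)] by (auto intro!: conj_mult)
  then show ?case using assms(3)[OF yz(2)] Suc.IH[OF yz(3)] by auto
qed

lemma generate_prods:
  assumes A: "A \<subseteq> carrier G" and inv: "\<And>x. x \<in> A \<Longrightarrow> inv x \<in> A"
  shows "x \<in> generate G A \<longleftrightarrow> (\<exists>n. x \<in> prods G A n)"
proof
  assume "x \<in> generate G A"
  then show "\<exists>n. x \<in> prods G A n"
  proof (induction rule: generate.induct)
    case one
    then show ?case by (intro exI[of _ 0]) simp
  next
    case (incl h)
    then show ?case using prods_single[OF A] by blast
  next
    case (inv h)
    then show ?case using prods_single[OF A] assms(2) by blast
  next
    case (eng h1 h2)
    then show ?case using prods_mult[OF A] by blast
  qed
next
  have "prods G A n \<subseteq> generate G A" for n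
    by (induction n) (auto intro: generate.intros)
  then show "\<exists>n. x \<in> prods G A n \<Longrightarrow> x \<in> generate G A" by blast
qed

end

section \<open>Branch groups in which the sum of the section lengths contracts\<close>

text \<open>The setting of the argument, freed from the tree: \<open>pr u v\<close> stands for the automorphism with sections
  \<open>u\<close> and \<open>v\<close>, and \<open>s\<close> for an element exchanging the two subtrees. The function \<open>pr\<close> is total but
  \<open>pr u v\<close> need not lie in the group, even for \<open>u\<close> and \<open>v\<close> in the group; \<open>pr_lift\<close> says that
  every element of the group occurs as a first section, and \<open>contraction\<close> that every element has
  sections after at most one exchange, with the sum of their lengths contracting by the factor \<open>q\<close>.\<close>

locale contracting_branch_group = normal K G for K and G (structure) +
  fixes pr :: "'a \<Rightarrow> 'a \<Rightarrow> 'a" and s :: 'a and len :: "'a \<Rightarrow> nat" and q C :: real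
  assumes pr_mult: "pr x y \<otimes> pr x' y' = pr (x \<otimes> x') (y \<otimes> y')"
    and pr_one: "pr \<one> \<one> = \<one>"
    and pr_inv: "x \<in> carrier G \<Longrightarrow> y \<in> carrier G \<Longrightarrow> pr x y \<in> carrier G \<Longrightarrow>
      inv (pr x y) = pr (inv x) (inv y)"
    and pr_K: "x \<in> K \<Longrightarrow> y \<in> K \<Longrightarrow> pr x y \<in> K"
    and pr_lift: "g \<in> carrier G \<Longrightarrow> \<exists>g'\<in>carrier G. pr g g' \<in> carrier G"
    and s_closed: "s \<in> carrier G"
    and s_swap: "x \<in> K \<Longrightarrow> y \<in> K \<Longrightarrow> s \<otimes> pr x y \<otimes> inv s = pr y x"
    and finite_cosets: "\<exists>R. finite R \<and> R \<subseteq> carrier G \<and>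
      (\<forall>g\<in>carrier G. \<exists>r\<in>R. \<exists>n\<in>generate G {comm g k | g k. g \<in> carrier G \<and> k \<in> K}. g = r \<otimes> n)"
    and len_mult: "g \<in> carrier G \<Longrightarrow> h \<in> carrier G \<Longrightarrow> len (g \<otimes> h) \<le> len g + len h"
    and finite_balls: "finite {g \<in> carrier G. len g \<le> n}"
    and contraction: "q < 1" "g \<in> carrier G \<Longrightarrow> \<exists>e\<in>{\<one>, s}. \<exists>g0\<in>carrier G. \<exists>g1\<in>carrier G.
      pr g0 g1 \<in> carrier G \<and> g = e \<otimes> pr g0 g1 \<and> len g0 + len g1 \<le> q * len g + C"
begin

definition mixed_comms :: "'a set" where
  "mixed_comms = {comm g k | g k. g \<in> carrier G \<and> k \<in> K}"

definition K_comms :: "'a set" where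
  "K_comms = {comm k k' | k k'. k \<in> K \<and> k' \<in> K}"

text \<open>The argument runs in \<open>N = [G, K]\<close> rather than in the derived subgroup: \<open>N\<close> is closed under \<open>pr\<close>, and
  in a mixed commutator \<open>[g, k]\<close> only the first entry has to be lifted through the tree, the second
  one can be paired with \<open>1\<close>.\<close>

abbreviation N :: "'a set" where "N \<equiv> generate G mixed_comms"

lemma K_carrier [simp]: "k \<in> K \<Longrightarrow> k \<in> carrier G"
  by (rule mem_carrier)

lemma K_conj: "g \<in> carrier G \<Longrightarrow> k \<in> K \<Longrightarrow> g \<otimes> k \<otimes> inv g \<in> K"
  by (rule inv_op_closed2)

lemma comm_in_K: "g \<in> carrier G \<Longrightarrow> k \<in> K \<Longrightarrow> comm g k \<in> K"
  unfolding comm_def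
  by (intro subgroup.m_closed[OF is_subgroup] K_conj subgroup.m_inv_closed[OF is_subgroup])

lemma mixed_comms_carrier: "mixed_comms \<subseteq> carrier G"
  by (auto simp: mixed_comms_def)

lemma mixed_comms_one: "\<one> \<in> mixed_comms"
  by (auto simp: mixed_comms_def intro!: exI[of _ \<one>])

text \<open>As \<open>[g, k]\<^sup>-\<^sup>1 = [g\<^sup>-\<^sup>1, g k g\<^sup>-\<^sup>1]\<close> has again its second entry in \<open>K\<close>, the elements of \<open>N\<close> are
  products of mixed commutators without inverses.\<close>

lemma mixed_comms_inv: "x \<in> mixed_comms \<Longrightarrow> inv x \<in> mixed_comms"
  using K_conj by (auto simp: mixed_comms_def comm_inverse; blast)

lemma K_comms_carrier: "K_comms \<subseteq> carrier G"
  by (auto simp: K_comms_def)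

lemma K_comms_one: "\<one> \<in> K_comms"
  using subgroup.one_closed[OF is_subgroup] by (auto simp: K_comms_def intro!: exI[of _ \<one>])

lemma K_comms_conj: "g \<in> carrier G \<Longrightarrow> x \<in> K_comms \<Longrightarrow> g \<otimes> x \<otimes> inv g \<in> K_comms"
  using K_conj by (auto simp: K_comms_def comm_conj; blast)

abbreviation V :: "nat \<Rightarrow> 'a set" where "V \<equiv> prods G K_comms"

lemmas V_mult = prods_mult[OF K_comms_carrier]
lemmas V_le = prods_le[OF K_comms_carrier K_comms_one]

lemma V_carrier: "v \<in> V n \<Longrightarrow> v \<in> carrier G"
  using prods_carrier[OF K_comms_carrier] by blast

lemma V_conj: "g \<in> carrier G \<Longrightarrow> v \<in> V n \<Longrightarrow> g \<otimes> v \<otimes> inv g \<in> V n"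
  by (rule prods_conj[OF K_comms_carrier _ K_comms_conj])

lemma V_move_right:
  assumes "g \<in> carrier G" "v \<in> V n"
  shows "\<exists>v'\<in>V n. v \<otimes> g = g \<otimes> v'"
  using assms V_conj[of "inv g" v n] V_carrier[OF assms(2)]
  by (intro bexI[of _ "inv g \<otimes> v \<otimes> g"]) (simp_all add: group_normalize)

lemma comm_in_V: "k \<in> K \<Longrightarrow> k' \<in> K \<Longrightarrow> comm k k' \<in> V 1"
  using prods_single[OF K_comms_carrier] by (auto simp: K_comms_def)

lemma V_in_K: "v \<in> V n \<Longrightarrow> v \<in> K"
proof (induction n arbitrary: v)
  case (Suc n)
  from Suc.prems obtain k k' w where "v = comm k k' \<otimes> w" "k \<in> K" "k' \<in> K" "w \<in> V n"
    by (auto simp: K_comms_def)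
  moreover from this have "comm k k' \<in> K" using comm_in_K K_carrier by blast
  ultimately show ?case using Suc.IH subgroup.m_closed[OF is_subgroup] by blast
next
  case 0
  then show ?case using subgroup.one_closed[OF is_subgroup] by simp
qed

lemma N_carrier: "n \<in> N \<Longrightarrow> n \<in> carrier G"
  using generate_in_carrier[OF mixed_comms_carrier] .

lemma N_subgroup: "subgroup N G"
  by (rule generate_is_subgroup[OF mixed_comms_carrier])

lemma N_prods: "n \<in> N \<longleftrightarrow> (\<exists>m. n \<in> prods G mixed_comms m)"
  by (rule generate_prods[OF mixed_comms_carrier mixed_comms_inv])

lemma N_in_K: "n \<in> N \<Longrightarrow> n \<in> K"
  using generate_subgroup_incl[OF _ is_subgroup, of mixed_comms] comm_in_K
  by (auto simp: mixed_comms_def)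

section \<open>Collecting mixed commutators\<close>

text \<open>One commutator \<open>[t, k]\<close> with free \<open>k\<close> in \<open>K\<close> for each entry \<open>t\<close> of a list. The list will be a
  transversal of \<open>K\<close>, so that the number of these factors stays fixed although the entries \<open>k\<close>
  range over an infinite group.\<close>

primrec slots :: "'a list \<Rightarrow> 'a set" where
  "slots [] = {\<one>}"
| "slots (t # ts) = {comm t k \<otimes> y | k y. k \<in> K \<and> y \<in> slots ts}"

definition collected :: "'a list \<Rightarrow> nat \<Rightarrow> 'a set" where
  "collected ts m = {y \<otimes> v | y v. y \<in> slots ts \<and> v \<in> V m}"

lemma slots_carrier: "set ts \<subseteq> carrier G \<Longrightarrow> y \<in> slots ts \<Longrightarrow> y \<in> carrier G"
  by (induction ts arbitrary: y) auto

lemma slots_one: "set ts \<subseteq> carrier G \<Longrightarrow> \<one> \<in> slots ts"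
proof (induction ts)
  case (Cons t ts)
  then show ?case
    using subgroup.one_closed[OF is_subgroup] by (auto intro!: exI[of _ \<one>])
qed simp

text \<open>Modulo commutators of \<open>K\<close> the map \<open>k \<mapsto> [t, k]\<close> is a homomorphism:
  \<open>[t, k k'] = [t, k] [k, [t, k']] [t, k']\<close>, and the middle factor has both entries in \<open>K\<close>.\<close>

lemma merge_same_slot:
  assumes "t \<in> carrier G" "k \<in> K" "k' \<in> K"
  shows "\<exists>v\<in>V 1. comm t k \<otimes> comm t k' = comm t (k \<otimes> k') \<otimes> v"
proof -
  let ?v = "inv (comm t k') \<otimes> comm (comm t k') k \<otimes> comm t k'"
  have "?v \<in> V 1"
    using V_conj[of "inv (comm t k')" _ 1] comm_in_V[OF comm_in_K[OF assms(1,3)] assms(2)] assms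
    by (metis K_carrier comm_closed inv_closed inv_inv)
  moreover have "comm t k \<otimes> comm t k' = comm t (k \<otimes> k') \<otimes> ?v"
    using assms by (simp add: group_normalize)
  ultimately show ?thesis by blast
qed

lemma swap_in_K:
  assumes "x \<in> K" "y \<in> K"
  shows "\<exists>v\<in>V 1. x \<otimes> y = y \<otimes> x \<otimes> v"
  using comm_in_V[of "inv x" "inv y"] assms
  by (intro bexI[of _ "comm (inv x) (inv y)"]) (simp_all add: group_normalize)

text \<open>The new commutator travels to the right, past one slot at a time, until it meets the slot of its
  own \<open>t\<close> and merges with it. Each slot costs at most one commutator of \<open>K\<close>, since all factors lie
  in \<open>K\<close>.\<close>

lemma slots_absorb:
  assumes "set ts \<subseteq> carrier G" "t \<in> set ts" "k \<in> K" "y \<in> slots ts"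
  shows "\<exists>y'\<in>slots ts. \<exists>v\<in>V (length ts). comm t k \<otimes> y = y' \<otimes> v"
  using assms
proof (induction ts arbitrary: y)
  case (Cons r ts)
  then obtain k' z where y: "y = comm r k' \<otimes> z" "k' \<in> K" "z \<in> slots ts"
    by auto
  have z: "z \<in> carrier G" using slots_carrier Cons.prems(1) y(3) by auto
  have r: "r \<in> carrier G" "t \<in> carrier G" using Cons.prems by auto
  show ?case
  proof (cases "t = r")
    case True
    obtain v where v: "v \<in> V 1" "comm t k \<otimes> comm t k' = comm t (k \<otimes> k') \<otimes> v"
      using merge_same_slot r Cons.prems y by blast
    obtain v' where v': "v' \<in> V 1" "v \<otimes> z = z \<otimes> v'"
      using V_move_right[OF z v(1)] by blast
    have "comm t k \<otimes> y = (comm t k \<otimes> comm t k') \<otimes> z"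
      using y r z True Cons.prems by (simp add: m_assoc)
    also have "\<dots> = comm t (k \<otimes> k') \<otimes> (v \<otimes> z)"
      using v(2) V_carrier[OF v(1)] r z Cons.prems y by (simp add: m_assoc)
    also have "\<dots> = (comm t (k \<otimes> k') \<otimes> z) \<otimes> v'"
      using v'(2) V_carrier[OF v'(1)] r z Cons.prems y by (simp add: m_assoc)
    finally have "comm t k \<otimes> y = (comm t (k \<otimes> k') \<otimes> z) \<otimes> v'" .
    moreover have "comm t (k \<otimes> k') \<otimes> z \<in> slots (r # ts)"
      using True y Cons.prems by auto
    moreover have "v' \<in> V (length (r # ts))"
      by (rule V_le[OF _ v'(1)]) simp
    ultimately show ?thesis by blast
  next
    case False
    then obtain z' v where z': "z' \<in> slots ts" "v \<in> V (length ts)" "comm t k \<otimes> z = z' \<otimes> v"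
      using Cons.IH[of z] Cons.prems y by auto
    obtain u where u: "u \<in> V 1"
      "comm t k \<otimes> comm r k' = comm r k' \<otimes> comm t k \<otimes> u"
      using swap_in_K comm_in_K r Cons.prems y by meson
    obtain u' where u': "u' \<in> V 1" "u \<otimes> z = z \<otimes> u'"
      using V_move_right[OF z u(1)] by blast
    note car = r z V_carrier[OF u(1)] V_carrier[OF u'(1)] V_carrier[OF z'(2)]
      K_carrier[OF y(2)] K_carrier[OF Cons.prems(3)]
      slots_carrier[OF _ z'(1)] Cons.prems(1)
    have "comm t k \<otimes> y = (comm t k \<otimes> comm r k') \<otimes> z"
      using y car by (simp add: m_assoc)
    also have "\<dots> = comm r k' \<otimes> (comm t k \<otimes> (u \<otimes> z))"
      using u(2) car by (simp add: m_assoc)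
    also have "\<dots> = comm r k' \<otimes> ((comm t k \<otimes> z) \<otimes> u')"
      using u'(2) car by (simp add: m_assoc)
    also have "\<dots> = (comm r k' \<otimes> z') \<otimes> (v \<otimes> u')"
      using z'(3) car by (simp add: m_assoc)
    finally have "comm t k \<otimes> y = (comm r k' \<otimes> z') \<otimes> (v \<otimes> u')" .
    moreover have "comm r k' \<otimes> z' \<in> slots (r # ts)"
      using y z' by auto
    moreover have "v \<otimes> u' \<in> V (length (r # ts))"
      using V_mult[OF z'(2) u'(1)] by simp
    ultimately show ?thesis by blast
  qed
qed simp

definition transversal :: "'a list \<Rightarrow> bool" where
  "transversal ts \<longleftrightarrow> set ts \<subseteq> carrier G \<and> (\<forall>g\<in>carrier G. \<exists>t\<in>set ts. \<exists>k\<in>K. g = t \<otimes> k)"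

lemma V_collected: "set ts \<subseteq> carrier G \<Longrightarrow> v \<in> V m \<Longrightarrow> v \<in> collected ts m"
  unfolding collected_def mem_Collect_eq using slots_one V_carrier
  by (intro exI[of _ \<one>] exI[of _ v]) simp

lemma collected_le: "m \<le> n \<Longrightarrow> x \<in> collected ts m \<Longrightarrow> x \<in> collected ts n"
  unfolding collected_def using V_le by blast

text \<open>Replacing \<open>g = t \<kappa>\<close> by its coset representative \<open>t\<close> costs one commutator of \<open>K\<close>, because
  \<open>[t \<kappa>, k] = t [\<kappa>, k] t\<^sup>-\<^sup>1 [t, k]\<close>; the slots then absorb \<open>[t, k]\<close>.\<close>

lemma collected_absorb:
  assumes ts: "transversal ts" and g: "g \<in> carrier G" and k: "k \<in> K" and w: "w \<in> collected ts m"
  shows "comm g k \<otimes> w \<in> collected ts (Suc (length ts) + m)"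
proof -
  have sub: "set ts \<subseteq> carrier G" using ts by (simp add: transversal_def)
  obtain t \<kappa> where t: "t \<in> set ts" "\<kappa> \<in> K" "g = t \<otimes> \<kappa>"
    using ts g by (auto simp: transversal_def)
  then have tc: "t \<in> carrier G" using sub by auto
  obtain y v where y: "y \<in> slots ts" "v \<in> V m" "w = y \<otimes> v"
    using w by (auto simp: collected_def)
  have yc: "y \<in> carrier G" by (rule slots_carrier[OF sub y(1)])
  let ?u = "t \<otimes> comm \<kappa> k \<otimes> inv t"
  have u: "?u \<in> V 1" by (rule V_conj[OF tc comm_in_V[OF t(2) k]])
  have "comm t k \<otimes> y \<in> carrier G" using tc k yc by simp
  from V_move_right[OF this u] obtain u'
    where u': "u' \<in> V 1" "?u \<otimes> (comm t k \<otimes> y) = (comm t k \<otimes> y) \<otimes> u'" by blast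
  obtain y' v' where y': "y' \<in> slots ts" "v' \<in> V (length ts)" "comm t k \<otimes> y = y' \<otimes> v'"
    using slots_absorb[OF sub t(1) k y(1)] by blast
  note car = tc yc K_carrier[OF k] K_carrier[OF t(2)] V_carrier[OF y(2)] V_carrier[OF u'(1)]
    V_carrier[OF y'(2)] slots_carrier[OF sub y'(1)]
  have "comm g k = ?u \<otimes> comm t k"
    using car t(3) by (simp add: group_normalize)
  then have "comm g k \<otimes> w = (?u \<otimes> (comm t k \<otimes> y)) \<otimes> v"
    using car y(3) by (simp add: m_assoc)
  also have "\<dots> = y' \<otimes> (v' \<otimes> u' \<otimes> v)"
    using u'(2) y'(3) car by (simp add: m_assoc)
  finally have "comm g k \<otimes> w = y' \<otimes> (v' \<otimes> u' \<otimes> v)" .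
  moreover have "v' \<otimes> u' \<otimes> v \<in> V (length ts + 1 + m)"
    by (intro V_mult y' u' y)
  ultimately show ?thesis using y'(1) by (auto simp: collected_def)
qed

lemma collected_prods:
  assumes ts: "transversal ts" and p: "p \<in> prods G mixed_comms n" and w: "w \<in> collected ts m"
  shows "p \<otimes> w \<in> collected ts (n * Suc (length ts) + m)"
  using p
proof (induction n arbitrary: p)
  case 0
  have "w \<in> carrier G"
    using w ts slots_carrier V_carrier by (auto simp: collected_def transversal_def)
  then show ?case using 0 w by simp
next
  case (Suc n)
  then obtain g k p' where p': "p = comm g k \<otimes> p'" "p' \<in> prods G mixed_comms n"
    "g \<in> carrier G" "k \<in> K"
    by (auto simp: mixed_comms_def)
  have "w \<in> carrier G"
    using w ts slots_carrier V_carrier by (auto simp: collected_def transversal_def)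
  then have "p \<otimes> w = comm g k \<otimes> (p' \<otimes> w)"
    using p' prods_carrier[OF mixed_comms_carrier] by (auto intro!: m_assoc)
  then show ?case
    using collected_absorb[OF ts p'(3,4) Suc.IH[OF p'(2)]] by (simp add: ac_simps)
qed

lemma N_collected:
  assumes ts: "transversal ts" and "n \<in> N"
  shows "\<exists>m. n \<in> collected ts m"
proof -
  obtain p where "n \<in> prods G mixed_comms p" using assms(2) N_prods by blast
  then have "n \<otimes> \<one> \<in> collected ts (p * Suc (length ts) + 0)"
    using ts by (intro collected_prods V_collected) (auto simp: transversal_def)
  then show ?thesis using N_carrier[OF assms(2)] by auto
qed

section \<open>Halving the number of commutators\<close>

lemma pr_closed: "x \<in> K \<Longrightarrow> y \<in> K \<Longrightarrow> pr x y \<in> carrier G"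
  by (rule K_carrier[OF pr_K])

lemma pr_comm:
  assumes "x \<in> carrier G" "x' \<in> carrier G" "pr x x' \<in> carrier G"
    and "y \<in> carrier G" "y' \<in> carrier G" "pr y y' \<in> carrier G"
  shows "comm (pr x x') (pr y y') = pr (comm x y) (comm x' y')"
  using assms by (simp add: comm_def pr_inv pr_mult)

text \<open>Embedding a product of mixed commutators into the first subtree does not lengthen it: if \<open>(g, g')\<close>
  is a lift of \<open>g\<close>, then \<open>[(g, g'), (k, 1)] = ([g, k], 1)\<close>.\<close>

lemma mixed_prods_pr:
  assumes "p \<in> prods G mixed_comms n"
  shows "pr p \<one> \<in> prods G mixed_comms n"
  using assms
proof (induction n arbitrary: p)
  case 0
  then show ?case by (simp add: pr_one)
next
  case (Suc n)
  from Suc.prems obtain g k p' where p': "p = comm g k \<otimes> p'" "p' \<in> prods G mixed_comms n"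
    "g \<in> carrier G" "k \<in> K"
    by (auto simp: mixed_comms_def)
  obtain g' where g': "g' \<in> carrier G" "pr g g' \<in> carrier G"
    using pr_lift[OF p'(3)] by blast
  have k: "pr k \<one> \<in> K" by (rule pr_K[OF p'(4) subgroup.one_closed[OF is_subgroup]])
  have "comm (pr g g') (pr k \<one>) = pr (comm g k) \<one>"
    using pr_comm[OF p'(3) g' _ _ K_carrier[OF k]] p'(4) g'(1) by simp
  then have "pr p \<one> = comm (pr g g') (pr k \<one>) \<otimes> pr p' \<one>"
    by (simp add: p'(1) pr_mult)
  moreover have "comm (pr g g') (pr k \<one>) \<in> mixed_comms"
    using g'(2) k by (auto simp: mixed_comms_def)
  ultimately show ?case using Suc.IH[OF p'(2)] by auto
qed

lemma slots_mixed_prods: "set ts \<subseteq> carrier G \<Longrightarrow> slots ts \<subseteq> prods G mixed_comms (length ts)"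
proof (induction ts)
  case (Cons t ts)
  then show ?case by (auto simp: mixed_comms_def; blast)
qed simp

lemma N_conj:
  assumes "g \<in> carrier G" "n \<in> N"
  shows "g \<otimes> n \<otimes> inv g \<in> N"
proof -
  have "g \<otimes> x \<otimes> inv g \<in> mixed_comms" if x: "x \<in> mixed_comms" for x
  proof -
    obtain h k where "x = comm h k" "h \<in> carrier G" "k \<in> K"
      using x by (auto simp: mixed_comms_def)
    then show ?thesis
      using assms(1) K_conj[OF assms(1), of k] by (auto simp: mixed_comms_def comm_conj)
  qed
  then show ?thesis
    using assms prods_conj[OF mixed_comms_carrier assms(1)] N_prods by blast
qed

lemma N_pr:
  assumes "x \<in> N" "y \<in> N"
  shows "pr x y \<in> N"
proof -
  have left: "pr n \<one> \<in> N" if "n \<in> N" for n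
    using that mixed_prods_pr N_prods by blast
  have one: "\<one> \<in> K" by (rule subgroup.one_closed[OF is_subgroup])
  have "s \<otimes> pr y \<one> \<otimes> inv s \<in> N"
    by (rule N_conj[OF s_closed left[OF assms(2)]])
  then have "pr \<one> y \<in> N"
    using s_swap[OF N_in_K[OF assms(2)] one] by simp
  then have "pr x \<one> \<otimes> pr \<one> y \<in> N"
    using left[OF assms(1)] subgroup.m_closed[OF N_subgroup] by blast
  then show ?thesis
    using assms[THEN N_carrier] by (simp add: pr_mult)
qed

text \<open>The source of the gain: commutators of \<open>K\<close> in the two subtrees are performed simultaneously, so
  two products of \<open>n\<close> commutators are paid for by \<open>n\<close> commutators. Mixed commutators could not be
  paired in this way, since \<open>(g, g')\<close> need not lie in the group.\<close>

lemma V_pr: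
  assumes "u \<in> V n" "v \<in> V n"
  shows "pr u v \<in> V n"
  using assms
proof (induction n arbitrary: u v)
  case 0
  then show ?case by (simp add: pr_one)
next
  case (Suc n)
  from Suc.prems(1) obtain x y u' where u: "u = comm x y \<otimes> u'" "x \<in> K" "y \<in> K" "u' \<in> V n"
    by (auto simp: K_comms_def)
  from Suc.prems(2) obtain z w v' where v: "v = comm z w \<otimes> v'" "z \<in> K" "w \<in> K" "v' \<in> V n"
    by (auto simp: K_comms_def)
  have "pr u v = comm (pr x z) (pr y w) \<otimes> pr u' v'"
    using u v pr_closed by (simp add: pr_comm pr_mult)
  moreover have "comm (pr x z) (pr y w) \<in> K_comms"
    using pr_K u v by (auto simp: K_comms_def)
  ultimately show ?case using Suc.IH[OF u(4) v(4)] by auto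
qed

text \<open>Let \<open>y\<^sub>0 y\<^sub>1 = p v\<^sub>1 v\<^sub>2\<close> with \<open>p\<close> a product of slots and \<open>v\<^sub>1\<close>, \<open>v\<^sub>2\<close> the two halves of the product of
  commutators of \<open>K\<close>. Putting \<open>\<kappa> = y\<^sub>1 v\<^sub>1\<^sup>-\<^sup>1\<close> and \<open>u = y\<^sub>1 v\<^sub>2 y\<^sub>1\<^sup>-\<^sup>1\<close>, one has
  \<open>(y\<^sub>0, y\<^sub>1) = (p, 1) (\<kappa>\<^sup>-\<^sup>1, \<kappa>) (u, v\<^sub>1)\<close>. The first factor consists of one mixed commutator for each slot,
  the second is the single mixed commutator \<open>[s, (\<kappa>, 1)]\<close>, and the last is only half as long as
  \<open>v\<^sub>1 v\<^sub>2\<close>.\<close>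

lemma collected_pr:
  assumes ts: "transversal ts" and y0: "y0 \<in> N" and y1: "y1 \<in> N"
    and w: "y0 \<otimes> y1 \<in> collected ts (m + m)"
  shows "pr y0 y1 \<in> collected ts (Suc (length ts) * Suc (length ts) + m)"
proof -
  have sub: "set ts \<subseteq> carrier G" using ts by (simp add: transversal_def)
  obtain p v where pv: "p \<in> slots ts" "v \<in> V (m + m)" "y0 \<otimes> y1 = p \<otimes> v"
    using w by (auto simp: collected_def)
  obtain v1 v2 where v: "v1 \<in> V m" "v2 \<in> V m" "v = v1 \<otimes> v2"
    using prods_split[OF K_comms_carrier pv(2)] by blast
  note car = N_carrier[OF y0] N_carrier[OF y1] V_carrier[OF v(1)] V_carrier[OF v(2)]
    slots_carrier[OF sub pv(1)]
  have one: "\<one> \<in> K" by (rule subgroup.one_closed[OF is_subgroup])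
  define u where "u = y1 \<otimes> v2 \<otimes> inv y1"
  have u: "u \<in> V m" unfolding u_def by (rule V_conj[OF car(2) v(2)])
  define \<kappa> where "\<kappa> = y1 \<otimes> inv v1"
  have \<kappa>: "\<kappa> \<in> K"
    unfolding \<kappa>_def by (intro subgroup.m_closed[OF is_subgroup] N_in_K[OF y1]
      subgroup.m_inv_closed[OF is_subgroup] V_in_K[OF v(1)])
  have i\<kappa>: "inv \<kappa> \<in> K" by (rule subgroup.m_inv_closed[OF is_subgroup \<kappa>])
  have c: "comm s (pr \<kappa> \<one>) = pr (inv \<kappa>) \<kappa>"
    using s_swap[OF \<kappa> one] \<kappa> one pr_closed by (simp add: comm_def pr_inv pr_mult)
  have y1': "y1 = \<kappa> \<otimes> v1"
    using car by (simp add: \<kappa>_def m_assoc)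
  have "y0 = p \<otimes> (v1 \<otimes> v2) \<otimes> inv y1"
    using inv_solve_right[of y0 "p \<otimes> (v1 \<otimes> v2)" y1] pv(3) v(3) car by simp
  also have "\<dots> = p \<otimes> inv \<kappa> \<otimes> u"
    using car by (simp add: \<kappa>_def u_def group_normalize)
  finally have y0': "y0 = p \<otimes> inv \<kappa> \<otimes> u" .
  have pK: "p \<in> carrier G" "u \<in> carrier G" "\<kappa> \<in> carrier G" "inv \<kappa> \<in> carrier G"
    using car \<kappa> V_carrier[OF u] by auto
  have "pr p \<one> \<in> prods G mixed_comms (length ts)"
    using mixed_prods_pr slots_mixed_prods[OF sub] pv(1) by blast
  moreover have "pr (inv \<kappa>) \<kappa> \<in> prods G mixed_comms (Suc 0)"
    using c[symmetric] pr_K[OF \<kappa> one] s_closed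
    by (intro prods_single[OF mixed_comms_carrier]) (unfold mixed_comms_def, blast)
  ultimately have "pr p \<one> \<otimes> pr (inv \<kappa>) \<kappa> \<in> prods G mixed_comms (length ts + Suc 0)"
    by (rule prods_mult[OF mixed_comms_carrier])
  then have "(pr p \<one> \<otimes> pr (inv \<kappa>) \<kappa>) \<otimes> pr u v1
      \<in> collected ts ((length ts + Suc 0) * Suc (length ts) + m)"
    by (rule collected_prods[OF ts _ V_collected[OF sub V_pr[OF u v(1)]]])
  moreover have "(pr p \<one> \<otimes> pr (inv \<kappa>) \<kappa>) \<otimes> pr u v1 = pr y0 y1"
    using pK by (subst y0', subst y1') (simp add: pr_mult)
  ultimately show ?thesis by simp
qed

section \<open>Descent along the length\<close>

lemma finite_cosets_N:
  obtains R where "finite R" "R \<subseteq> carrier G" "\<And>g. g \<in> carrier G \<Longrightarrow> \<exists>r\<in>R. \<exists>n\<in>N. g = r \<otimes> n"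
  using finite_cosets unfolding mixed_comms_def by blast

lemma transversal_exists: "\<exists>ts. transversal ts"
proof -
  obtain R where R: "finite R" "R \<subseteq> carrier G"
    "\<And>g. g \<in> carrier G \<Longrightarrow> \<exists>r\<in>R. \<exists>n\<in>N. g = r \<otimes> n"
    using finite_cosets_N by blast
  then obtain ts where "set ts = R" using finite_list by blast
  then have "transversal ts" using R N_in_K unfolding transversal_def by blast
  then show ?thesis ..
qed

text \<open>Up to left multiplication by finitely many elements, every element of \<open>N\<close> is a pair \<open>(n\<^sub>0, n\<^sub>1)\<close> of
  elements of \<open>N\<close>: replace each section by the element of \<open>N\<close> in its coset. The correcting factors
  lie in \<open>N\<close> themselves because \<open>(n\<^sub>0, n\<^sub>1)\<close> does, and the representatives, being finitely many, change
  the lengths by a bounded amount.\<close>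

lemma descent_step:
  obtains F C' where "finite F" "F \<subseteq> N"
    "\<And>g. g \<in> N \<Longrightarrow> \<exists>r\<in>F. \<exists>n0\<in>N. \<exists>n1\<in>N.
      g = r \<otimes> pr n0 n1 \<and> real (len (n0 \<otimes> n1)) \<le> q * len g + C'"
proof -
  obtain R where R: "finite R" "R \<subseteq> carrier G"
    "\<And>g. g \<in> carrier G \<Longrightarrow> \<exists>r\<in>R. \<exists>n\<in>N. g = r \<otimes> n"
    using finite_cosets_N by blast
  define B where "B = Max (insert 0 ((\<lambda>r. len (inv r)) ` R))"
  have B: "len (inv r) \<le> B" if "r \<in> R" for r
    unfolding B_def using that R(1) by (intro Max_ge) auto
  define F where "F = (\<lambda>(e, r0, r1). e \<otimes> pr r0 r1) ` ({\<one>, s} \<times> R \<times> R) \<inter> N"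
  have "\<exists>r\<in>F. \<exists>n0\<in>N. \<exists>n1\<in>N.
      g = r \<otimes> pr n0 n1 \<and> real (len (n0 \<otimes> n1)) \<le> q * len g + (C + 2 * real B)" if g: "g \<in> N" for g
  proof -
    obtain e g0 g1 where e: "e \<in> {\<one>, s}" and g01: "g0 \<in> carrier G" "g1 \<in> carrier G"
      "pr g0 g1 \<in> carrier G" "g = e \<otimes> pr g0 g1" "real (len g0 + len g1) \<le> q * len g + C"
      using contraction(2)[OF N_carrier[OF g]] by blast
    obtain r0 n0 r1 n1 where r: "r0 \<in> R" "r1 \<in> R" and n: "n0 \<in> N" "n1 \<in> N"
      and eq: "g0 = r0 \<otimes> n0" "g1 = r1 \<otimes> n1"
      using R(3)[OF g01(1)] R(3)[OF g01(2)] by blast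
    have rc: "r0 \<in> carrier G" "r1 \<in> carrier G" "n0 \<in> carrier G" "n1 \<in> carrier G"
      "e \<in> carrier G"
      using R(2) r n[THEN N_carrier] e s_closed by auto
    have p: "pr n0 n1 \<in> N" by (rule N_pr[OF n])
    then have pc: "pr n0 n1 \<in> carrier G" by (rule N_carrier)
    have "pr r0 r1 = pr g0 g1 \<otimes> inv (pr n0 n1)"
      using rc pc by (simp add: pr_inv pr_mult eq m_assoc)
    then have rr: "pr r0 r1 \<in> carrier G" using g01(3) pc by simp
    have g_eq: "g = (e \<otimes> pr r0 r1) \<otimes> pr n0 n1"
      using g01(4) rc rr pc by (simp add: eq pr_mult m_assoc)
    then have "e \<otimes> pr r0 r1 = g \<otimes> inv (pr n0 n1)"
      using inv_solve_right[of "e \<otimes> pr r0 r1" g "pr n0 n1"] rc rr pc N_carrier[OF g] by simp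
    then have "e \<otimes> pr r0 r1 \<in> N"
      using g p subgroup.m_closed[OF N_subgroup] subgroup.m_inv_closed[OF N_subgroup] by metis
    then have F: "e \<otimes> pr r0 r1 \<in> F"
      using e r unfolding F_def by force
    have "len n0 \<le> len g0 + B"
      using len_mult[of "inv r0" g0] B[OF r(1)] rc g01(1) by (simp add: eq cancel_left)
    moreover have "len n1 \<le> len g1 + B"
      using len_mult[of "inv r1" g1] B[OF r(2)] rc g01(2) by (simp add: eq cancel_left)
    moreover have "len (n0 \<otimes> n1) \<le> len n0 + len n1"
      by (rule len_mult[OF rc(3,4)])
    ultimately have "real (len (n0 \<otimes> n1)) \<le> q * len g + (C + 2 * real B)"
      using g01(5) by linarith
    then show ?thesis using F n g_eq by blast
  qed
  moreover have "finite F" "F \<subseteq> N" unfolding F_def using R(1) by auto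
  ultimately show thesis using that by blast
qed

text \<open>Let \<open>c\<close> be the cost of one descent step, so that parameter \<open>2M\<close> for \<open>n\<^sub>0 n\<^sub>1\<close> gives \<open>M + c\<close> for \<open>g\<close>.
  Any \<open>M \<ge> c\<close> is stable under the descent, and \<open>M\<close> is also taken large enough for the finitely many
  elements of \<open>N\<close> that the descent does not shorten.\<close>

lemma N_uniformly_collected:
  assumes ts: "transversal ts"
  shows "\<exists>M. \<forall>g\<in>N. g \<in> collected ts M"
proof -
  obtain F C' where F: "finite F" "F \<subseteq> N" and step:
    "\<And>g. g \<in> N \<Longrightarrow> \<exists>r\<in>F. \<exists>n0\<in>N. \<exists>n1\<in>N.
      g = r \<otimes> pr n0 n1 \<and> real (len (n0 \<otimes> n1)) \<le> q * len g + C'"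
    using descent_step by blast
  have "\<exists>l. \<forall>r\<in>F. r \<in> prods G mixed_comms l"
    using F N_prods prods_le[OF mixed_comms_carrier mixed_comms_one]
    by (intro finite_uniform_bound) blast+
  then obtain l where l: "\<And>r. r \<in> F \<Longrightarrow> r \<in> prods G mixed_comms l" by blast
  define L where "L = Suc (length ts)"
  define c where "c = l * L + L * L"
  \<comment> \<open>Beyond the fixed point of \<open>x \<mapsto> q x + C'\<close> the descent strictly decreases the length.\<close>
  define n where "n = nat \<lceil>C' / (1 - q)\<rceil>"
  have short: "len h < len g" if "real (len h) \<le> q * len g + C'" "n < len g" for g h
  proof -
    have "C' / (1 - q) < len g" using that(2) unfolding n_def by linarith
    then have "C' < len g * (1 - q)" using contraction(1) by (simp add: divide_less_eq)
    then show ?thesis using that(1) by (simp add: algebra_simps)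
  qed
  have "\<exists>m. \<forall>g\<in>{g \<in> carrier G. len g \<le> n} \<inter> N. g \<in> collected ts m"
    using finite_balls[of n] N_collected[OF ts] collected_le
    by (intro finite_uniform_bound) auto
  then obtain m where m: "\<And>g. g \<in> N \<Longrightarrow> len g \<le> n \<Longrightarrow> g \<in> collected ts m"
    using N_carrier by blast
  define M where "M = c + m"
  have "g \<in> collected ts (M + M)" if "g \<in> N" for g
    using that
  proof (induction "len g" arbitrary: g rule: less_induct)
    case less
    show ?case
    proof (cases "len g \<le> n")
      case True
      show ?thesis
        by (rule collected_le[OF _ m[OF less.prems True]]) (simp add: M_def)
    next
      case False
      obtain r n0 n1 where r: "r \<in> F" "n0 \<in> N" "n1 \<in> N" "g = r \<otimes> pr n0 n1"
        "real (len (n0 \<otimes> n1)) \<le> q * len g + C'"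
        using step[OF less.prems] by blast
      have "n0 \<otimes> n1 \<in> collected ts (M + M)"
        using less.hyps short[OF r(5)] False subgroup.m_closed[OF N_subgroup r(2,3)] by simp
      then have "pr n0 n1 \<in> collected ts (L * L + M)"
        unfolding L_def by (rule collected_pr[OF ts r(2,3)])
      then have "g \<in> collected ts (l * L + (L * L + M))"
        unfolding L_def r(4) by (rule collected_prods[OF ts l[OF r(1)]])
      then show ?thesis by (rule collected_le[rotated]) (simp add: M_def c_def)
    qed
  qed
  then show ?thesis by blast
qed

lemma derived_set_eq: "derived_set G H = {comm x y | x y. x \<in> H \<and> y \<in> H}"
  by (auto simp: comm_def)

text \<open>Modulo \<open>N\<close> an element of the derived subgroup is one of finitely many representatives; those that
  occur are themselves in the derived subgroup, hence products of boundedly many commutators.\<close>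

theorem finite_commutator_width:
  "\<exists>M. \<forall>g\<in>derived G (carrier G). g \<in> prods G (derived_set G (carrier G)) M"
proof -
  let ?D = "derived_set G (carrier G)"
  have D: "?D \<subseteq> carrier G" by auto
  have D1: "\<one> \<in> ?D" unfolding derived_set_eq by (auto intro!: exI[of _ \<one>])
  have "inv x \<in> ?D" if "x \<in> ?D" for x
    using that unfolding derived_set_eq
    using comm_inverse inv_closed m_closed by blast
  note D_prods = generate_prods[OF D this, folded derived_def]
  have mD: "mixed_comms \<subseteq> ?D" and KD: "K_comms \<subseteq> ?D"
    unfolding derived_set_eq mixed_comms_def K_comms_def by (blast intro: K_carrier)+
  obtain ts where ts: "transversal ts" using transversal_exists by blast
  then have sub: "set ts \<subseteq> carrier G" by (simp add: transversal_def)
  obtain M where M: "\<And>g. g \<in> N \<Longrightarrow> g \<in> collected ts M"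
    using N_uniformly_collected[OF ts] by blast
  have N: "g \<in> prods G ?D (length ts + M)" if gN: "g \<in> N" for g
  proof -
    obtain y v where "g = y \<otimes> v" "y \<in> slots ts" "v \<in> V M"
      using M[OF gN] by (auto simp: collected_def)
    then show ?thesis
      using slots_mixed_prods[OF sub] prods_mono[OF mD] prods_mono[OF KD]
      by (blast intro: prods_mult[OF D])
  qed
  obtain R where R: "finite R" "R \<subseteq> carrier G"
    "\<And>g. g \<in> carrier G \<Longrightarrow> \<exists>r\<in>R. \<exists>n\<in>N. g = r \<otimes> n"
    using finite_cosets_N by blast
  have "\<exists>l. \<forall>r\<in>R \<inter> derived G (carrier G). r \<in> prods G ?D l"
    using R(1) D_prods prods_le[OF D D1]
    by (intro finite_uniform_bound) blast+
  then obtain l where l: "\<And>r. r \<in> R \<Longrightarrow> r \<in> derived G (carrier G) \<Longrightarrow> r \<in> prods G ?D l"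
    by blast
  have "g \<in> prods G ?D (l + (length ts + M))" if g: "g \<in> derived G (carrier G)" for g
  proof -
    have sg: "subgroup (derived G (carrier G)) G" by (rule derived_is_subgroup) simp
    have gc: "g \<in> carrier G" by (rule subgroup.mem_carrier[OF sg g])
    then obtain r n where r: "r \<in> R" "n \<in> N" "g = r \<otimes> n" using R(3) by blast
    have n: "n \<in> derived G (carrier G)" using N[OF r(2)] D_prods by blast
    have "r = g \<otimes> inv n"
      using r R(2) N_carrier[OF r(2)] by (auto simp: m_assoc)
    then have "r \<in> derived G (carrier G)"
      using subgroup.m_closed[OF sg g subgroup.m_inv_closed[OF sg n]] by simp
    then show ?thesis
      unfolding r(3) using l[OF r(1)] N[OF r(2)] by (intro prods_mult[OF D]) auto
  qed
  then show ?thesis by blast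
qed

end

section \<open>Words in the generators of the Grigorchuk group\<close>

datatype letter = A | B | C | D

primrec gen :: "letter \<Rightarrow> bool list \<Rightarrow> bool list" where
  "gen A = grig_a" | "gen B = grig_b" | "gen C = grig_c" | "gen D = grig_d"

primrec ev :: "letter list \<Rightarrow> bool list \<Rightarrow> bool list" where
  "ev [] = id"
| "ev (l # w) = gen l \<circ> ev w"

fun tree_pair :: "(bool list \<Rightarrow> bool list) \<Rightarrow> (bool list \<Rightarrow> bool list) \<Rightarrow> bool list \<Rightarrow> bool list" where
  "tree_pair u v [] = []"
| "tree_pair u v (False # w) = False # u w"
| "tree_pair u v (True # w) = True # v w"

lemma ev_append: "ev (u @ v) = ev u \<circ> ev v"
  by (induction u) (simp_all add: comp_assoc)

lemma tree_pair_comp [simp]: "tree_pair u v \<circ> tree_pair u' v' = tree_pair (u \<circ> u') (v \<circ> v')"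
proof
  fix w
  show "(tree_pair u v \<circ> tree_pair u' v') w = tree_pair (u \<circ> u') (v \<circ> v') w"
    by (cases w rule: grig_a.cases) auto
qed

lemma tree_pair_id: "tree_pair id id = id"
proof
  fix w
  show "tree_pair id id w = id w" by (cases w rule: grig_a.cases) auto
qed

lemma gen_sections:
  "grig_b = tree_pair grig_a grig_c" "grig_c = tree_pair grig_a grig_d"
  "grig_d = tree_pair id grig_b"
proof -
  have "grig_b w = tree_pair grig_a grig_c w" "grig_c w = tree_pair grig_a grig_d w"
    "grig_d w = tree_pair id grig_b w" for w
    by (cases w rule: grig_a.cases; simp)+
  then show "grig_b = tree_pair grig_a grig_c" "grig_c = tree_pair grig_a grig_d"
    "grig_d = tree_pair id grig_b" by blast+
qed

lemma gen_invol:
  "grig_a \<circ> grig_a = id" "grig_b \<circ> grig_b = id" "grig_c \<circ> grig_c = id" "grig_d \<circ> grig_d = id"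
  by (simp_all add: fun_eq_iff grig_invol)

lemma comp_cancel:
  "grig_a \<circ> (grig_a \<circ> f) = f" "grig_b \<circ> (grig_b \<circ> f) = f"
  "grig_c \<circ> (grig_c \<circ> f) = f" "grig_d \<circ> (grig_d \<circ> f) = f"
  by (simp_all flip: comp_assoc add: gen_invol)

lemmas word_simps = comp_assoc comp_cancel gen_invol

lemma gen_comp_gen: "gen l \<circ> gen l = id"
  by (cases l) (simp_all add: gen_invol)

text \<open>The set \<open>{1, b, c, d}\<close> is a Klein four-group.\<close>

lemma klein_four:
  "grig_b \<circ> grig_c = grig_d" "grig_c \<circ> grig_d = grig_b" "grig_d \<circ> grig_b = grig_c"
proof -
  have "grig_b (grig_c w) = grig_d w" "grig_c (grig_d w) = grig_b w" "grig_d (grig_b w) = grig_c w"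
    for w
    by (induction w and w and w rule: grig_b_grig_c_grig_d.induct) (simp_all add: grig_invol)
  then show "grig_b \<circ> grig_c = grig_d" "grig_c \<circ> grig_d = grig_b" "grig_d \<circ> grig_b = grig_c"
    by (simp_all add: fun_eq_iff)
qed

lemma klein_four':
  "grig_c \<circ> grig_b = grig_d" "grig_d \<circ> grig_c = grig_b" "grig_b \<circ> grig_d = grig_c"
proof -
  show "grig_b \<circ> grig_d = grig_c"
    by (metis comp_assoc gen_invol(2) id_comp klein_four(1))
  show "grig_c \<circ> grig_b = grig_d"
    by (metis comp_assoc gen_invol(3) id_comp klein_four(2))
  show "grig_d \<circ> grig_c = grig_b"
    by (metis comp_assoc gen_invol(4) id_comp klein_four(3))
qed

lemma a_swap: "grig_a \<circ> tree_pair u v = tree_pair v u \<circ> grig_a"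
proof
  fix w
  show "(grig_a \<circ> tree_pair u v) w = (tree_pair v u \<circ> grig_a) w"
    by (cases w rule: grig_a.cases) auto
qed

lemma a_conj: "grig_a \<circ> tree_pair u v \<circ> grig_a = tree_pair v u"
  by (simp add: a_swap comp_assoc gen_invol)

abbreviation \<Gamma> :: "(bool list \<Rightarrow> bool list) monoid" where
  "\<Gamma> \<equiv> Grigorchuk_group"

lemma Gamma_mult [simp]: "x \<otimes>\<^bsub>\<Gamma>\<^esub> y = x \<circ> y" and Gamma_one [simp]: "\<one>\<^bsub>\<Gamma>\<^esub> = id"
  by (simp_all add: Grigorchuk_group_def subgroup_generated_def tree_Aut_def)

lemma range_gen: "range gen = {grig_a, grig_b, grig_c, grig_d}"
proof -
  have "UNIV = {A, B, C, D}" using letter.exhaust by blast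
  then have "range gen = gen ` {A, B, C, D}" by simp
  then show ?thesis by simp
qed

lemma carrier_Gamma: "carrier \<Gamma> = range ev"
proof -
  interpret T: group tree_Aut by (rule group_tree_Aut)
  have gens: "gen l \<in> carrier tree_Aut" for l
    using grig_gens_in_tree_Aut range_gen by blast
  have inv: "inv\<^bsub>tree_Aut\<^esub> (gen l) = gen l" for l
    by (rule T.inv_equality) (use gens gen_comp_gen in \<open>simp_all add: tree_Aut_def\<close>)
  have "carrier \<Gamma> = generate tree_Aut (range gen)"
    using grig_gens_in_tree_Aut
    by (simp add: Grigorchuk_group_def carrier_subgroup_generated range_gen Int_absorb1)
  also have "\<dots> = range ev"
  proof (intro equalityI subsetI)
    fix g assume "g \<in> generate tree_Aut (range gen)"
    then show "g \<in> range ev"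
    proof (induction rule: generate.induct)
      case one
      then show ?case by (auto simp: tree_Aut_def intro!: range_eqI[of _ _ "[]"])
    next
      case (incl h)
      then obtain l where "h = gen l" by blast
      then show ?case by (intro range_eqI[of _ _ "[l]"]) simp
    next
      case (inv h)
      then obtain l where "h = gen l" by blast
      then show ?case using \<open>\<And>l. inv\<^bsub>tree_Aut\<^esub> (gen l) = gen l\<close>
        by (intro range_eqI[of _ _ "[l]"]) simp
    next
      case (eng g h)
      then obtain u v where "g = ev u" "h = ev v" by blast
      then show ?case by (intro range_eqI[of _ _ "u @ v"]) (simp add: tree_Aut_def ev_append)
    qed
  next
    fix g assume "g \<in> range ev"
    then obtain w where "g = ev w" by blast
    moreover have "ev w \<in> generate tree_Aut (range gen)"
    proof (induction w)
      case Nil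
      show ?case
        using generate.one[of tree_Aut "range gen"] by (simp only: ev.simps tree_Aut_def monoid.simps)
    next
      case (Cons l w)
      show ?case
        using generate.eng[OF generate.incl[OF rangeI] Cons.IH, of l]
        by (simp only: ev.simps tree_Aut_def monoid.simps)
    qed
    ultimately show "g \<in> generate tree_Aut (range gen)" by simp
  qed
  finally show ?thesis .
qed

interpretation \<Gamma>: group \<Gamma>
  by (rule group_Grigorchuk_group)

lemma ev_in_Gamma [simp]: "ev w \<in> carrier \<Gamma>"
  by (simp add: carrier_Gamma)

lemma gen_in_Gamma [simp]:
  "grig_a \<in> carrier \<Gamma>" "grig_b \<in> carrier \<Gamma>" "grig_c \<in> carrier \<Gamma>" "grig_d \<in> carrier \<Gamma>"
  using ev_in_Gamma[of "[A]"] ev_in_Gamma[of "[B]"] ev_in_Gamma[of "[C]"] ev_in_Gamma[of "[D]"]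
  by simp_all

lemma comp_in_Gamma [simp]: "g \<in> carrier \<Gamma> \<Longrightarrow> h \<in> carrier \<Gamma> \<Longrightarrow> g \<circ> h \<in> carrier \<Gamma>"
  using \<Gamma>.m_closed by simp

lemma id_in_Gamma [simp]: "id \<in> carrier \<Gamma>"
  using \<Gamma>.one_closed by simp

lemma comp_inv_Gamma: "g \<in> carrier \<Gamma> \<Longrightarrow> g \<circ> inv\<^bsub>\<Gamma>\<^esub> g = id" "g \<in> carrier \<Gamma> \<Longrightarrow> inv\<^bsub>\<Gamma>\<^esub> g \<circ> g = id"
  using \<Gamma>.r_inv \<Gamma>.l_inv by simp_all

lemma inv_Gamma_eqI: "g \<in> carrier \<Gamma> \<Longrightarrow> h \<circ> g = id \<Longrightarrow> h \<in> carrier \<Gamma> \<Longrightarrow> inv\<^bsub>\<Gamma>\<^esub> g = h"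
  using \<Gamma>.inv_equality by simp

lemma tree_pair_inv:
  assumes "x \<in> carrier \<Gamma>" "y \<in> carrier \<Gamma>" "tree_pair x y \<in> carrier \<Gamma>"
  shows "inv\<^bsub>\<Gamma>\<^esub> (tree_pair x y) = tree_pair (inv\<^bsub>\<Gamma>\<^esub> x) (inv\<^bsub>\<Gamma>\<^esub> y)"
proof -
  have "inv\<^bsub>\<Gamma>\<^esub> (tree_pair x y) \<circ> (tree_pair x y \<circ> tree_pair (inv\<^bsub>\<Gamma>\<^esub> x) (inv\<^bsub>\<Gamma>\<^esub> y))
      = inv\<^bsub>\<Gamma>\<^esub> (tree_pair x y)"
    unfolding tree_pair_comp by (simp add: assms comp_inv_Gamma tree_pair_id)
  then show ?thesis
    unfolding comp_assoc[symmetric] by (simp add: assms comp_inv_Gamma)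
qed

text \<open>It suffices to lift the generators, and this is done by the elements \<open>b = (a, c)\<close>, \<open>a d a = (b, 1)\<close>,
  \<open>a b a = (c, a)\<close> and \<open>a c a = (d, a)\<close>.\<close>

lemma tree_pair_lift:
  assumes "g \<in> carrier \<Gamma>"
  shows "\<exists>g'\<in>carrier \<Gamma>. tree_pair g g' \<in> carrier \<Gamma>"
proof -
  have "\<exists>g'\<in>carrier \<Gamma>. tree_pair (ev w) g' \<in> carrier \<Gamma>" for w
  proof (induction w)
    case Nil
    show ?case
      using id_in_Gamma unfolding ev.simps by (intro bexI[of _ id]) (simp_all only: tree_pair_id)
  next
    case (Cons l w)
    then obtain g' where g': "g' \<in> carrier \<Gamma>" "tree_pair (ev w) g' \<in> carrier \<Gamma>" by blast
    have "grig_a \<circ> grig_b \<circ> grig_a \<in> carrier \<Gamma>" "grig_a \<circ> grig_c \<circ> grig_a \<in> carrier \<Gamma>"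
      "grig_a \<circ> grig_d \<circ> grig_a \<in> carrier \<Gamma>"
      by simp_all
    moreover have "grig_a \<circ> grig_b \<circ> grig_a = tree_pair grig_c grig_a"
      "grig_a \<circ> grig_c \<circ> grig_a = tree_pair grig_d grig_a"
      "grig_a \<circ> grig_d \<circ> grig_a = tree_pair grig_b id"
      using a_conj[of grig_a grig_c] a_conj[of grig_a grig_d] a_conj[of id grig_b]
      by (simp_all flip: gen_sections)
    moreover have "tree_pair grig_a grig_c \<in> carrier \<Gamma>"
      by (simp flip: gen_sections)
    ultimately have "\<exists>l'\<in>carrier \<Gamma>. tree_pair (gen l) l' \<in> carrier \<Gamma>"
      using gen_in_Gamma id_in_Gamma by (cases l) auto
    then obtain l' where l': "l' \<in> carrier \<Gamma>" "tree_pair (gen l) l' \<in> carrier \<Gamma>" by blast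
    have "tree_pair (gen l) l' \<circ> tree_pair (ev w) g' \<in> carrier \<Gamma>"
      using l'(2) g'(2) by (rule comp_in_Gamma)
    then have "tree_pair (ev (l # w)) (l' \<circ> g') \<in> carrier \<Gamma>"
      by (simp only: tree_pair_comp ev.simps)
    then show ?case using comp_in_Gamma[OF l'(1) g'(1)] by blast
  qed
  then show ?thesis using assms by (auto simp: carrier_Gamma)
qed

section \<open>The branching subgroup\<close>

definition grig_x :: "bool list \<Rightarrow> bool list" where
  "grig_x = grig_a \<circ> grig_b \<circ> grig_a \<circ> grig_b"

definition grig_K :: "(bool list \<Rightarrow> bool list) set" where
  "grig_K = generate \<Gamma> {g \<otimes>\<^bsub>\<Gamma>\<^esub> grig_x \<otimes>\<^bsub>\<Gamma>\<^esub> inv\<^bsub>\<Gamma>\<^esub> g | g. g \<in> carrier \<Gamma>}"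

lemma x_in_Gamma [simp]: "grig_x \<in> carrier \<Gamma>"
  by (simp add: grig_x_def)

lemma inv_x: "inv\<^bsub>\<Gamma>\<^esub> grig_x = grig_b \<circ> grig_a \<circ> grig_b \<circ> grig_a"
  by (rule inv_Gamma_eqI) (simp_all add: grig_x_def word_simps)

lemma inv_a [simp]: "inv\<^bsub>\<Gamma>\<^esub> grig_a = grig_a"
  by (rule inv_Gamma_eqI; simp add: gen_invol)

lemma K_normal: "grig_K \<lhd> \<Gamma>"
  unfolding grig_K_def
proof (rule \<Gamma>.normal_generateI)
  let ?X = "{g \<otimes>\<^bsub>\<Gamma>\<^esub> grig_x \<otimes>\<^bsub>\<Gamma>\<^esub> inv\<^bsub>\<Gamma>\<^esub> g | g. g \<in> carrier \<Gamma>}"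
  show "?X \<subseteq> carrier \<Gamma>" by (auto simp del: Gamma_mult)
  fix h g assume h: "h \<in> ?X" and g: "g \<in> carrier \<Gamma>"
  then obtain f where f: "h = f \<otimes>\<^bsub>\<Gamma>\<^esub> grig_x \<otimes>\<^bsub>\<Gamma>\<^esub> inv\<^bsub>\<Gamma>\<^esub> f" "f \<in> carrier \<Gamma>" by blast
  then have "g \<otimes>\<^bsub>\<Gamma>\<^esub> h \<otimes>\<^bsub>\<Gamma>\<^esub> inv\<^bsub>\<Gamma>\<^esub> g = (g \<otimes>\<^bsub>\<Gamma>\<^esub> f) \<otimes>\<^bsub>\<Gamma>\<^esub> grig_x \<otimes>\<^bsub>\<Gamma>\<^esub> inv\<^bsub>\<Gamma>\<^esub> (g \<otimes>\<^bsub>\<Gamma>\<^esub> f)"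
    using g by (simp add: \<Gamma>.m_assoc \<Gamma>.inv_mult_group del: Gamma_mult)
  then show "g \<otimes>\<^bsub>\<Gamma>\<^esub> h \<otimes>\<^bsub>\<Gamma>\<^esub> inv\<^bsub>\<Gamma>\<^esub> g \<in> ?X"
    using \<Gamma>.m_closed[OF g f(2)] by blast
qed

interpretation K: normal grig_K \<Gamma>
  by (rule K_normal)

lemma x_in_K: "grig_x \<in> grig_K"
proof -
  have "grig_x = id \<otimes>\<^bsub>\<Gamma>\<^esub> grig_x \<otimes>\<^bsub>\<Gamma>\<^esub> inv\<^bsub>\<Gamma>\<^esub> id"
    using \<Gamma>.inv_one by simp
  then show ?thesis unfolding grig_K_def using id_in_Gamma by (blast intro: generate.incl)
qed

lemma x_sections: "grig_x = tree_pair (grig_c \<circ> grig_a) (grig_a \<circ> grig_c)"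
  "inv\<^bsub>\<Gamma>\<^esub> grig_x = tree_pair (grig_a \<circ> grig_c) (grig_c \<circ> grig_a)"
proof -
  have aba: "grig_a \<circ> grig_b \<circ> grig_a = tree_pair grig_c grig_a"
    using a_conj[of grig_a grig_c] by (simp flip: gen_sections)
  have "grig_x = (grig_a \<circ> grig_b \<circ> grig_a) \<circ> grig_b"
    by (simp add: grig_x_def)
  also have "\<dots> = tree_pair grig_c grig_a \<circ> tree_pair grig_a grig_c"
    by (simp only: aba gen_sections(1)[symmetric])
  finally show "grig_x = tree_pair (grig_c \<circ> grig_a) (grig_a \<circ> grig_c)" by simp
  have "inv\<^bsub>\<Gamma>\<^esub> grig_x = grig_b \<circ> (grig_a \<circ> grig_b \<circ> grig_a)"
    by (simp add: inv_x comp_assoc)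
  also have "\<dots> = tree_pair grig_a grig_c \<circ> tree_pair grig_c grig_a"
    by (simp only: aba gen_sections(1)[symmetric])
  finally show "inv\<^bsub>\<Gamma>\<^esub> grig_x = tree_pair (grig_a \<circ> grig_c) (grig_c \<circ> grig_a)" by simp
qed

text \<open>With \<open>x = (ab)\<^sup>2 = (ca, ac)\<close> and \<open>d' = a d a = (b, 1)\<close>, the second section of \<open>[x, d']\<close> is trivial,
  while its first section is \<open>ca b ac b = c x c\<close>. Conjugation by \<open>a b a = (c, a)\<close> turns \<open>(c x c, 1)\<close>
  into \<open>(x, 1)\<close>.\<close>

lemma x_pair_id_in_K: "tree_pair grig_x id \<in> grig_K"
proof -
  define d' where "d' = grig_a \<circ> grig_d \<circ> grig_a"
  define t where "t = grig_a \<circ> grig_b \<circ> grig_a"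
  have d': "d' = tree_pair grig_b id"
    using a_conj[of id grig_b] by (simp add: d'_def flip: gen_sections)
  have t: "t = tree_pair grig_c grig_a"
    using a_conj[of grig_a grig_c] by (simp add: t_def flip: gen_sections)
  have in\<Gamma>: "d' \<in> carrier \<Gamma>" "t \<in> carrier \<Gamma>" by (simp_all add: d'_def t_def)
  have "d' \<otimes>\<^bsub>\<Gamma>\<^esub> inv\<^bsub>\<Gamma>\<^esub> grig_x \<otimes>\<^bsub>\<Gamma>\<^esub> inv\<^bsub>\<Gamma>\<^esub> d' \<in> grig_K"
    by (rule K.inv_op_closed2[OF in\<Gamma>(1) K.m_inv_closed[OF x_in_K]])
  then have "grig_x \<otimes>\<^bsub>\<Gamma>\<^esub> (d' \<otimes>\<^bsub>\<Gamma>\<^esub> inv\<^bsub>\<Gamma>\<^esub> grig_x \<otimes>\<^bsub>\<Gamma>\<^esub> inv\<^bsub>\<Gamma>\<^esub> d') \<in> grig_K"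
    by (rule K.m_closed[OF x_in_K])
  from K.inv_op_closed2[OF in\<Gamma>(2) this]
  have "t \<circ> (grig_x \<circ> (d' \<circ> inv\<^bsub>\<Gamma>\<^esub> grig_x \<circ> inv\<^bsub>\<Gamma>\<^esub> d')) \<circ> inv\<^bsub>\<Gamma>\<^esub> t \<in> grig_K"
    by simp
  moreover have "inv\<^bsub>\<Gamma>\<^esub> d' = d'" "inv\<^bsub>\<Gamma>\<^esub> t = t"
    by (rule inv_Gamma_eqI; simp add: d'_def t_def word_simps)+
  moreover have "t \<circ> (grig_x \<circ> (d' \<circ> inv\<^bsub>\<Gamma>\<^esub> grig_x \<circ> d')) \<circ> t = tree_pair grig_x id"
  proof -
    have "grig_b \<circ> (grig_c \<circ> f) = grig_c \<circ> (grig_b \<circ> f)" for f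
      by (simp flip: comp_assoc add: klein_four klein_four')
    then have "grig_c \<circ> (grig_c \<circ> grig_a \<circ> (grig_b \<circ> (grig_a \<circ> grig_c) \<circ> grig_b)) \<circ> grig_c = grig_x"
      by (simp add: grig_x_def word_simps klein_four klein_four')
    moreover have "grig_a \<circ> (grig_a \<circ> grig_c \<circ> (id \<circ> (grig_c \<circ> grig_a) \<circ> id)) \<circ> grig_a = id"
      by (simp add: word_simps)
    ultimately show ?thesis
      unfolding t d' x_sections(2) tree_pair_comp x_sections(1)[symmetric]
      by (subst x_sections(1)) (simp only: tree_pair_comp)
  qed
  ultimately show ?thesis by simp
qed

text \<open>The conjugates of \<open>(x, 1)\<close> by lifts of all elements \<open>g\<close> are the pairs \<open>(g x g\<^sup>-\<^sup>1, 1)\<close>, so \<open>K \<times> 1\<close> is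
  contained in \<open>K\<close>; conjugation by \<open>a\<close> gives \<open>1 \<times> K\<close>.\<close>

lemma tree_pair_K:
  assumes "x \<in> grig_K" "y \<in> grig_K"
  shows "tree_pair x y \<in> grig_K"
proof -
  have conj: "tree_pair h id \<in> grig_K"
    if h: "h \<in> {g \<otimes>\<^bsub>\<Gamma>\<^esub> grig_x \<otimes>\<^bsub>\<Gamma>\<^esub> inv\<^bsub>\<Gamma>\<^esub> g | g. g \<in> carrier \<Gamma>}" for h
  proof -
    obtain g where g: "h = g \<circ> grig_x \<circ> inv\<^bsub>\<Gamma>\<^esub> g" "g \<in> carrier \<Gamma>"
      using h unfolding Gamma_mult by blast
    obtain g' where g': "g' \<in> carrier \<Gamma>" "tree_pair g g' \<in> carrier \<Gamma>"
      using tree_pair_lift[OF g(2)] by blast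
    have "tree_pair g g' \<circ> tree_pair grig_x id \<circ> inv\<^bsub>\<Gamma>\<^esub> (tree_pair g g') \<in> grig_K"
      using K.inv_op_closed2[OF g'(2) x_pair_id_in_K] unfolding Gamma_mult .
    moreover have "tree_pair g g' \<circ> tree_pair grig_x id \<circ> inv\<^bsub>\<Gamma>\<^esub> (tree_pair g g') = tree_pair h id"
      unfolding tree_pair_inv[OF g(2) g'] tree_pair_comp
      by (simp add: comp_inv_Gamma(1)[OF g'(1)] g(1))
    ultimately show ?thesis by (simp only:)
  qed
  have left: "tree_pair z id \<in> grig_K" if "z \<in> grig_K" for z
    using that[unfolded grig_K_def]
  proof (induction rule: generate.induct)
    case one
    then show ?case using K.one_closed by (simp only: tree_pair_id Gamma_one)
  next
    case (incl h)
    then show ?case by (rule conj)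
  next
    case (inv h)
    then have h: "h \<in> carrier \<Gamma>" by auto
    have K: "tree_pair h id \<in> grig_K" by (rule conj[OF inv])
    have "inv\<^bsub>\<Gamma>\<^esub> (tree_pair h id) = tree_pair (inv\<^bsub>\<Gamma>\<^esub> h) id"
      using tree_pair_inv[OF h id_in_Gamma K.mem_carrier[OF K]] \<Gamma>.inv_one by simp
    then show ?case using K.m_inv_closed[OF K] by (simp only:)
  next
    case (eng g h)
    then show ?case using K.m_closed[OF eng.IH] by (simp only: Gamma_mult tree_pair_comp comp_id)
  qed
  have "grig_a \<circ> tree_pair y id \<circ> inv\<^bsub>\<Gamma>\<^esub> grig_a \<in> grig_K"
    using K.inv_op_closed2[OF _ left[OF assms(2)], of grig_a] by simp
  then have "tree_pair id y \<in> grig_K" by (simp add: a_conj)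
  from K.m_closed[OF left[OF assms(1)] this] show ?thesis
    by (simp only: Gamma_mult tree_pair_comp comp_id id_comp)
qed

section \<open>Finite index\<close>

text \<open>The subgroup generated by \<open>a\<close> and \<open>d\<close>, which is dihedral of order \<open>8\<close>.\<close>

definition dihedral :: "(bool list \<Rightarrow> bool list) set" where
  "dihedral = ev ` {[], [A], [D], [A, D], [D, A], [A, D, A], [D, A, D], [A, D, A, D]}"

text \<open>Equivalently \<open>(ad)\<^sup>4 = 1\<close>. It holds because \<open>a d a = (b, 1)\<close> and \<open>d = (1, b)\<close> act on different
  subtrees and so commute.\<close>

lemma ad_order_four: "grig_d \<circ> (grig_a \<circ> (grig_d \<circ> grig_a)) = grig_a \<circ> (grig_d \<circ> (grig_a \<circ> grig_d))"
proof -
  have ada: "grig_a \<circ> (grig_d \<circ> grig_a) = tree_pair grig_b id"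
    using a_conj[of id grig_b] by (simp add: comp_assoc flip: gen_sections)
  have "grig_d \<circ> (grig_a \<circ> (grig_d \<circ> grig_a)) = tree_pair id grig_b \<circ> tree_pair grig_b id"
    by (simp only: ada gen_sections(3)[symmetric])
  also have "\<dots> = tree_pair grig_b id \<circ> tree_pair id grig_b" by simp
  also have "\<dots> = (grig_a \<circ> (grig_d \<circ> grig_a)) \<circ> grig_d"
    by (simp only: ada gen_sections(3)[symmetric])
  finally show ?thesis by (simp add: comp_assoc)
qed

lemma dihedral_mult:
  assumes "u \<in> dihedral"
  shows "grig_a \<circ> u \<in> dihedral" "grig_d \<circ> u \<in> dihedral"
proof -
  have "grig_d \<circ> (grig_a \<circ> (grig_d \<circ> (grig_a \<circ> grig_d))) = grig_a \<circ> (grig_d \<circ> grig_a)"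
    by (simp flip: ad_order_four add: comp_cancel)
  then show "grig_a \<circ> u \<in> dihedral" "grig_d \<circ> u \<in> dihedral"
    using assms unfolding dihedral_def by (auto simp: word_simps ad_order_four)
qed

text \<open>Modulo \<open>K\<close> the element \<open>b\<close> is central: it commutes with \<open>d\<close>, and with \<open>a\<close> up to \<open>x = (ab)\<^sup>2\<close>. As
  \<open>c = b d\<close>, the quotient is generated by \<open>b\<close> and the finite dihedral group, and is thus finite.\<close>

lemma finite_index_K:
  assumes "g \<in> carrier \<Gamma>"
  shows "\<exists>r\<in>dihedral \<union> (\<circ>) grig_b ` dihedral. \<exists>k\<in>grig_K. g = r \<circ> k"
proof -
  let ?S = "dihedral \<union> (\<circ>) grig_b ` dihedral"
  have dih: "u \<in> carrier \<Gamma>" if "u \<in> dihedral" for u using that by (auto simp: dihedral_def)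
  have step: "\<exists>r'\<in>?S. \<exists>k\<in>grig_K. gen l \<circ> r = r' \<circ> k" if r: "r \<in> ?S" for l r
  proof -
    have id_K: "id \<in> grig_K" using K.one_closed by simp
    have *: ?thesis if "gen l \<circ> r \<in> ?S"
      using that id_K by (intro bexI[of _ "gen l \<circ> r"] bexI[of _ id]) simp_all
    consider (plain) u where "u \<in> dihedral" "r = u" | (b) u where "u \<in> dihedral" "r = grig_b \<circ> u"
      using r by auto
    then show ?thesis
    proof cases
      case plain
      have "grig_c \<circ> r = grig_b \<circ> (grig_d \<circ> r)"
        by (simp flip: comp_assoc add: klein_four')
      then have "gen l \<circ> r \<in> ?S"
        using plain dihedral_mult[of r] by (cases l) auto
      then show ?thesis by (rule *)
    next
      case b
      show ?thesis
      proof (cases "l = A")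
        case True
        have "inv\<^bsub>\<Gamma>\<^esub> u \<circ> grig_x \<circ> u \<in> grig_K"
          using K.inv_op_closed1[OF dih[OF b(1)] x_in_K] by simp
        moreover have "grig_b \<circ> (grig_a \<circ> u) \<in> ?S" using dihedral_mult b by auto
        moreover have "gen l \<circ> r = (grig_b \<circ> (grig_a \<circ> u)) \<circ> (inv\<^bsub>\<Gamma>\<^esub> u \<circ> grig_x \<circ> u)"
        proof -
          have "u \<circ> (inv\<^bsub>\<Gamma>\<^esub> u \<circ> f) = f" for f :: "bool list \<Rightarrow> bool list"
            using comp_inv_Gamma(1)[OF dih[OF b(1)]] by (simp flip: comp_assoc)
          then have "(grig_b \<circ> (grig_a \<circ> u)) \<circ> (inv\<^bsub>\<Gamma>\<^esub> u \<circ> grig_x \<circ> u)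
              = grig_b \<circ> (grig_a \<circ> (grig_x \<circ> u))"
            by (simp add: comp_assoc)
          then show ?thesis using True b by (simp add: grig_x_def word_simps)
        qed
        ultimately show ?thesis by blast
      next
        case False
        have "grig_b \<circ> (grig_b \<circ> u) = u" "grig_c \<circ> (grig_b \<circ> u) = grig_d \<circ> u"
          "grig_d \<circ> (grig_b \<circ> u) = grig_b \<circ> (grig_d \<circ> u)"
          by (simp_all flip: comp_assoc add: klein_four klein_four' gen_invol)
        then have "gen l \<circ> r \<in> ?S"
          using False b dihedral_mult by (cases l) auto
        then show ?thesis by (rule *)
      qed
    qed
  qed
  have "\<exists>r\<in>?S. \<exists>k\<in>grig_K. ev w = r \<circ> k" for w
  proof (induction w)
    case Nil
    have "id \<in> dihedral" by (auto simp: dihedral_def intro!: image_eqI[of _ _ "[]"])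
    then show ?case using K.one_closed by (auto intro!: bexI[of _ id])
  next
    case (Cons l w)
    then obtain r k where r: "r \<in> ?S" "k \<in> grig_K" "ev w = r \<circ> k" by blast
    obtain r' k' where r': "r' \<in> ?S" "k' \<in> grig_K" "gen l \<circ> r = r' \<circ> k'"
      using step[OF r(1)] by blast
    have "ev (l # w) = r' \<circ> (k' \<circ> k)"
      using r(3) r'(3) by (simp flip: comp_assoc)
    moreover have "k' \<circ> k \<in> grig_K" using K.m_closed[OF r'(2) r(2)] by simp
    ultimately show ?case using r'(1) by blast
  qed
  then show ?thesis using assms by (auto simp: carrier_Gamma)
qed


text \<open>Every conjugate of \<open>x\<close> is congruent to \<open>x\<close> modulo \<open>M = [\<Gamma>, K]\<close>, so \<open>K / M\<close> is generated by the image
  of \<open>x\<close>. Since \<open>a x a = x\<^sup>-\<^sup>1\<close>, the commutator \<open>[a, x] = x\<^sup>-\<^sup>2\<close> lies in \<open>M\<close>, and \<open>K = M \<union> x M\<close>. In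
  the proof \<open>P\<close> denotes this union, shown to be closed under multiplication by \<open>K\<close>.\<close>

lemma finite_index_mixed_commutators:
  defines "M \<equiv> generate \<Gamma> {\<Gamma>.comm g k | g k. g \<in> carrier \<Gamma> \<and> k \<in> grig_K}"
  shows "\<exists>R. finite R \<and> R \<subseteq> carrier \<Gamma> \<and>
    (\<forall>g\<in>carrier \<Gamma>. \<exists>r\<in>R. \<exists>n\<in>M. g = r \<otimes>\<^bsub>\<Gamma>\<^esub> n)"
proof -
  let ?Cs = "{\<Gamma>.comm g k | g k. g \<in> carrier \<Gamma> \<and> k \<in> grig_K}"
  let ?x = grig_x
  note [simp del] = Gamma_mult
  have Cs: "?Cs \<subseteq> carrier \<Gamma>"
    using K.mem_carrier by blast
  have "\<Gamma>.comm g k \<in> ?Cs" if "g \<in> carrier \<Gamma>" "k \<in> grig_K" for g k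
    using that by blast
  then have comm_M: "\<Gamma>.comm g k \<in> M" if "g \<in> carrier \<Gamma>" "k \<in> grig_K" for g k
    using that unfolding M_def by (blast intro: generate.incl)
  have M_normal: "M \<lhd> \<Gamma>"
    unfolding M_def
  proof (rule \<Gamma>.normal_generateI[OF Cs])
    fix h g assume "h \<in> ?Cs" and g: "g \<in> carrier \<Gamma>"
    then obtain f k where f: "h = \<Gamma>.comm f k" "f \<in> carrier \<Gamma>" "k \<in> grig_K" by blast
    then have "g \<otimes>\<^bsub>\<Gamma>\<^esub> h \<otimes>\<^bsub>\<Gamma>\<^esub> inv\<^bsub>\<Gamma>\<^esub> g
        = \<Gamma>.comm (g \<otimes>\<^bsub>\<Gamma>\<^esub> f \<otimes>\<^bsub>\<Gamma>\<^esub> inv\<^bsub>\<Gamma>\<^esub> g) (g \<otimes>\<^bsub>\<Gamma>\<^esub> k \<otimes>\<^bsub>\<Gamma>\<^esub> inv\<^bsub>\<Gamma>\<^esub> g)"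
      using g K.mem_carrier by (simp add: \<Gamma>.comm_conj)
    moreover have "g \<otimes>\<^bsub>\<Gamma>\<^esub> f \<otimes>\<^bsub>\<Gamma>\<^esub> inv\<^bsub>\<Gamma>\<^esub> g \<in> carrier \<Gamma>"
      using f(2) g by simp
    moreover have "g \<otimes>\<^bsub>\<Gamma>\<^esub> k \<otimes>\<^bsub>\<Gamma>\<^esub> inv\<^bsub>\<Gamma>\<^esub> g \<in> grig_K"
      by (rule K.inv_op_closed2[OF g f(3)])
    ultimately show "g \<otimes>\<^bsub>\<Gamma>\<^esub> h \<otimes>\<^bsub>\<Gamma>\<^esub> inv\<^bsub>\<Gamma>\<^esub> g \<in> ?Cs" by blast
  qed
  interpret M: normal M \<Gamma> by (rule M_normal)
  define P where "P = M \<union> (\<lambda>n. ?x \<otimes>\<^bsub>\<Gamma>\<^esub> n) ` M"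
  have a_x: "grig_a \<otimes>\<^bsub>\<Gamma>\<^esub> ?x \<otimes>\<^bsub>\<Gamma>\<^esub> inv\<^bsub>\<Gamma>\<^esub> grig_a = inv\<^bsub>\<Gamma>\<^esub> ?x"
    by (simp add: inv_x Gamma_mult) (simp add: grig_x_def word_simps)
  have x2: "?x \<otimes>\<^bsub>\<Gamma>\<^esub> ?x \<in> M"
  proof -
    have "inv\<^bsub>\<Gamma>\<^esub> (\<Gamma>.comm grig_a ?x) \<in> M"
      by (intro M.m_inv_closed comm_M x_in_K) simp
    moreover have "\<Gamma>.comm grig_a ?x = inv\<^bsub>\<Gamma>\<^esub> ?x \<otimes>\<^bsub>\<Gamma>\<^esub> inv\<^bsub>\<Gamma>\<^esub> ?x"
      by (simp only: \<Gamma>.comm_def a_x)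
    ultimately show ?thesis by (simp add: \<Gamma>.inv_mult_group)
  qed
  have P_carrier: "p \<in> carrier \<Gamma>" if "p \<in> P" for p
    using that[unfolded P_def]
  proof
    assume "p \<in> (\<lambda>n. ?x \<otimes>\<^bsub>\<Gamma>\<^esub> n) ` M"
    then show ?thesis
      by (elim imageE) (simp only: \<Gamma>.m_closed[OF x_in_Gamma M.mem_carrier])
  qed (rule M.mem_carrier)
  have P_cases: "p \<in> M \<or> (\<exists>n. n \<in> M \<and> p = ?x \<otimes>\<^bsub>\<Gamma>\<^esub> n)" if "p \<in> P" for p
    using that unfolding P_def by (elim UnE imageE) (simp, blast)
  have x_P: "?x \<otimes>\<^bsub>\<Gamma>\<^esub> p \<in> P" if p: "p \<in> P" for p
  proof -
    consider "p \<in> M" | n where "n \<in> M" "p = ?x \<otimes>\<^bsub>\<Gamma>\<^esub> n"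
      using P_cases[OF p] by (elim disjE exE conjE)
    then show ?thesis
    proof cases
      case 1
      then show ?thesis unfolding P_def by blast
    next
      case 2
      have "?x \<otimes>\<^bsub>\<Gamma>\<^esub> p = (?x \<otimes>\<^bsub>\<Gamma>\<^esub> ?x) \<otimes>\<^bsub>\<Gamma>\<^esub> n"
        unfolding 2(2)
        by (rule \<Gamma>.m_assoc[symmetric, OF x_in_Gamma x_in_Gamma M.mem_carrier[OF 2(1)]])
      then show ?thesis
        unfolding P_def using M.m_closed[OF x2 2(1)] by (simp only: UnI1)
    qed
  qed
  have M_P: "n \<otimes>\<^bsub>\<Gamma>\<^esub> p \<in> P" if n: "n \<in> M" and p: "p \<in> P" for n p
  proof -
    consider "p \<in> M" | n' where "n' \<in> M" "p = ?x \<otimes>\<^bsub>\<Gamma>\<^esub> n'"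
      using P_cases[OF p] by (elim disjE exE conjE)
    then show ?thesis
    proof cases
      case 1
      then show ?thesis unfolding P_def using M.m_closed[OF n] by blast
    next
      case 2
      have "n \<otimes>\<^bsub>\<Gamma>\<^esub> p = ?x \<otimes>\<^bsub>\<Gamma>\<^esub> ((inv\<^bsub>\<Gamma>\<^esub> ?x \<otimes>\<^bsub>\<Gamma>\<^esub> n \<otimes>\<^bsub>\<Gamma>\<^esub> ?x) \<otimes>\<^bsub>\<Gamma>\<^esub> n')"
        using M.mem_carrier[OF n] M.mem_carrier[OF 2(1)]
        by (simp add: 2(2) \<Gamma>.group_normalize)
      moreover have "(inv\<^bsub>\<Gamma>\<^esub> ?x \<otimes>\<^bsub>\<Gamma>\<^esub> n \<otimes>\<^bsub>\<Gamma>\<^esub> ?x) \<otimes>\<^bsub>\<Gamma>\<^esub> n' \<in> M"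
        using M.inv_op_closed1[OF x_in_Gamma n] 2(1) by (rule M.m_closed)
      ultimately show ?thesis unfolding P_def by blast
    qed
  qed
  have x_inv_P: "inv\<^bsub>\<Gamma>\<^esub> ?x \<otimes>\<^bsub>\<Gamma>\<^esub> p \<in> P" if p: "p \<in> P" for p
  proof -
    have pc: "p \<in> carrier \<Gamma>" by (rule P_carrier[OF p])
    have "inv\<^bsub>\<Gamma>\<^esub> ?x \<otimes>\<^bsub>\<Gamma>\<^esub> p = inv\<^bsub>\<Gamma>\<^esub> (?x \<otimes>\<^bsub>\<Gamma>\<^esub> ?x) \<otimes>\<^bsub>\<Gamma>\<^esub> (?x \<otimes>\<^bsub>\<Gamma>\<^esub> p)"
      using pc by (simp add: \<Gamma>.group_normalize)
    then show ?thesis using M_P[OF M.m_inv_closed[OF x2] x_P[OF p]] by simp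
  qed
  let ?X = "{g \<otimes>\<^bsub>\<Gamma>\<^esub> ?x \<otimes>\<^bsub>\<Gamma>\<^esub> inv\<^bsub>\<Gamma>\<^esub> g | g. g \<in> carrier \<Gamma>}"
  have conj_P: "h \<otimes>\<^bsub>\<Gamma>\<^esub> p \<in> P \<and> inv\<^bsub>\<Gamma>\<^esub> h \<otimes>\<^bsub>\<Gamma>\<^esub> p \<in> P" if h: "h \<in> ?X" and p: "p \<in> P" for h p
  proof -
    obtain g where g: "h = g \<otimes>\<^bsub>\<Gamma>\<^esub> ?x \<otimes>\<^bsub>\<Gamma>\<^esub> inv\<^bsub>\<Gamma>\<^esub> g" "g \<in> carrier \<Gamma>"
      using h by blast
    have pc: "p \<in> carrier \<Gamma>" by (rule P_carrier[OF p])
    let ?c = "\<Gamma>.comm g ?x"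
    have c: "?c \<in> M" by (rule comm_M[OF g(2) x_in_K])
    have "h \<otimes>\<^bsub>\<Gamma>\<^esub> p = ?c \<otimes>\<^bsub>\<Gamma>\<^esub> (?x \<otimes>\<^bsub>\<Gamma>\<^esub> p)"
      using g pc by (simp add: \<Gamma>.group_normalize)
    moreover have "inv\<^bsub>\<Gamma>\<^esub> h \<otimes>\<^bsub>\<Gamma>\<^esub> p = inv\<^bsub>\<Gamma>\<^esub> ?x \<otimes>\<^bsub>\<Gamma>\<^esub> (inv\<^bsub>\<Gamma>\<^esub> ?c \<otimes>\<^bsub>\<Gamma>\<^esub> p)"
      using g pc by (simp add: \<Gamma>.group_normalize)
    ultimately show ?thesis
      using M_P[OF c x_P[OF p]] x_inv_P[OF M_P[OF M.m_inv_closed[OF c] p]] by simp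
  qed
  have K_mult_P: "k \<otimes>\<^bsub>\<Gamma>\<^esub> p \<in> P" if "k \<in> grig_K" "p \<in> P" for k p
    using that(1)[unfolded grig_K_def] that(2)
  proof (induction arbitrary: p rule: generate.induct)
    case one
    then show ?case using P_carrier[OF one] by (simp del: Gamma_one)
  next
    case (incl h)
    then show ?case using conj_P by blast
  next
    case (inv h)
    then show ?case using conj_P by blast
  next
    case (eng h1 h2)
    have "h1 \<in> carrier \<Gamma>" "h2 \<in> carrier \<Gamma>"
      using eng.hyps[folded grig_K_def] K.mem_carrier by blast+
    then show ?case
      using eng.IH(1)[OF eng.IH(2)[OF eng.prems]] P_carrier[OF eng.prems]
      by (simp add: \<Gamma>.m_assoc)
  qed
  have K_P: "k \<in> P" if "k \<in> grig_K" for k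
  proof -
    have "\<one>\<^bsub>\<Gamma>\<^esub> \<in> P" unfolding P_def using M.one_closed by blast
    from K_mult_P[OF that this] show ?thesis
      using K.mem_carrier[OF that] by (simp del: Gamma_one)
  qed
  let ?S = "dihedral \<union> (\<circ>) grig_b ` dihedral"
  let ?R = "?S \<union> (\<lambda>r. r \<circ> ?x) ` ?S"
  have S: "?S \<subseteq> carrier \<Gamma>" by (auto simp: dihedral_def)
  have R_finite: "finite ?R" by (simp add: dihedral_def)
  have R_carrier: "?R \<subseteq> carrier \<Gamma>" using S comp_in_Gamma x_in_Gamma by blast
  have R_covers: "\<exists>r\<in>?R. \<exists>n\<in>M. g = r \<otimes>\<^bsub>\<Gamma>\<^esub> n" if g: "g \<in> carrier \<Gamma>" for g
  proof -
    obtain r k where r: "r \<in> ?S" "k \<in> grig_K" "g = r \<circ> k"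
      using finite_index_K[OF g] by blast
    consider "k \<in> M" | n where "n \<in> M" "k = ?x \<circ> n"
      using P_cases[OF K_P[OF r(2)]] unfolding Gamma_mult by (elim disjE exE conjE)
    then show ?thesis
    proof cases
      case 1
      then show ?thesis using r unfolding Gamma_mult by blast
    next
      case 2
      have "g = (r \<circ> ?x) \<circ> n" using 2(2) r(3) by (simp only: comp_assoc)
      moreover have "r \<circ> ?x \<in> ?R" using r(1) by blast
      ultimately show ?thesis using 2(1) unfolding Gamma_mult by blast
    qed
  qed
  show ?thesis by (intro exI[of _ ?R] conjI ballI R_finite R_carrier R_covers)
qed

section \<open>Contraction of the weighted word length\<close>

text \<open>Passing to sections turns \<open>b\<close> into \<open>(a, c)\<close>, \<open>c\<close> into \<open>(a, d)\<close> and \<open>d\<close> into \<open>(1, b)\<close>, and in an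
  alternating word each of these letters is accompanied by one letter \<open>a\<close>, which disappears. With
  unit weights a word could keep its total length. The weights are chosen so that each of
  \<open>ab, ac, ad\<close>, of weight \<open>6, 5, 4\<close>, produces sections of weight at most \<open>5/6\<close> of its own, namely
  \<open>5, 4, 3\<close>, and so that no product of two of \<open>b, c, d\<close> outweighs its factors.\<close>

primrec weight :: "letter \<Rightarrow> nat" where
  "weight A = 3" | "weight B = 3" | "weight C = 2" | "weight D = 1"

abbreviation word_weight :: "letter list \<Rightarrow> nat" where
  "word_weight w \<equiv> sum_list (map weight w)"

fun alternating :: "letter list \<Rightarrow> bool" where
  "alternating (l # m # w) \<longleftrightarrow> (l = A \<longleftrightarrow> m \<noteq> A) \<and> alternating (m # w)"
| "alternating _ \<longleftrightarrow> True"

lemma merge_letters: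
  assumes "(l = A) = (m = A)"
  shows "ev (l # m # w) = ev w \<or>
    (\<exists>n. n \<noteq> A \<and> m \<noteq> A \<and> ev (l # m # w) = ev (n # w) \<and> weight n \<le> weight l + weight m)"
proof -
  have "ev (l # m # w) = (gen l \<circ> gen m) \<circ> ev w" by (simp add: comp_assoc)
  moreover have "gen l \<circ> gen m = id \<or>
    (\<exists>n. n \<noteq> A \<and> m \<noteq> A \<and> gen l \<circ> gen m = gen n \<and> weight n \<le> weight l + weight m)"
  proof (cases "l = m")
    case True
    then show ?thesis by (simp add: gen_comp_gen)
  next
    case False
    have "gen B = grig_b" "gen C = grig_c" "gen D = grig_d" by simp_all
    then show ?thesis
      using assms False klein_four klein_four'
      by (cases l; cases m) (auto intro: exI[of _ B] exI[of _ C] exI[of _ D])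
  qed
  ultimately show ?thesis by auto
qed

lemma alternating_tl: "alternating (l # w) \<Longrightarrow> alternating w"
  by (cases w) auto

lemma alternating_representative:
  "\<exists>w'. alternating w' \<and> ev w' = ev w \<and> word_weight w' \<le> word_weight w"
proof (induction w)
  case Nil
  show ?case by (intro exI[of _ "[]"]) simp
next
  case (Cons l w)
  then obtain u where u: "alternating u" "ev u = ev w" "word_weight u \<le> word_weight w"
    by blast
  have eq: "ev (l # u) = ev (l # w)" using u(2) by simp
  show ?case
  proof (cases "alternating (l # u)")
    case True
    then show ?thesis using eq u(3) by (intro exI[of _ "l # u"]) simp
  next
    case False
    then obtain m v where m: "u = m # v" "(l = A) = (m = A)"
      using u(1) by (cases u) auto
    have v: "alternating v" using u(1) m(1) alternating_tl by blast
    from merge_letters[OF m(2), of v] show ?thesis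
    proof
      assume "ev (l # m # v) = ev v"
      then show ?thesis using eq u(3) m(1) v by (intro exI[of _ v]) simp
    next
      assume "\<exists>n. n \<noteq> A \<and> m \<noteq> A \<and> ev (l # m # v) = ev (n # v) \<and> weight n \<le> weight l + weight m"
      then obtain n where n: "n \<noteq> A" "m \<noteq> A" "ev (l # m # v) = ev (n # v)"
        "weight n \<le> weight l + weight m" by blast
      have "alternating (n # v)" using n(1,2) u(1) m(1) by (cases v) auto
      then show ?thesis using n(3,4) eq u(3) m(1) by (intro exI[of _ "n # v"]) simp
    qed
  qed
qed

text \<open>A letter \<open>b\<close>, \<open>c\<close> or \<open>d\<close> alone does not contract; it does so together with a neighbouring \<open>a\<close>, whose
  weight \<open>3\<close> contributes \<open>15\<close> to the right-hand side and nothing to the left. The term \<open>15\<close> is the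
  debt of a leading letter that has not yet been matched with an \<open>a\<close> to its left.\<close>

lemma alternating_sections:
  assumes "alternating w"
  shows "\<exists>e\<in>{id, grig_a}. \<exists>u v. ev w = e \<circ> tree_pair (ev u) (ev v) \<and>
    6 * (word_weight u + word_weight v)
      \<le> 5 * word_weight w + (if w = [] \<or> hd w = A then 0 else 15)"
  using assms
proof (induction w)
  case Nil
  show ?case using tree_pair_id by (auto intro!: bexI[of _ id] exI[of _ "[]"])
next
  case (Cons l w)
  from Cons.IH[OF alternating_tl[OF Cons.prems]] obtain e u v
    where e: "e \<in> {id, grig_a}" "ev w = e \<circ> tree_pair (ev u) (ev v)"
    and wt: "6 * (word_weight u + word_weight v)
      \<le> 5 * word_weight w + (if w = [] \<or> hd w = A then 0 else 15)"
    by blast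
  let ?bound = "5 * word_weight (l # w) + (if l # w = [] \<or> hd (l # w) = A then 0 else 15)"
  have result: ?case
    if "e' \<in> {id, grig_a}" "ev (l # w) = e' \<circ> tree_pair (ev u') (ev v')"
      "6 * (word_weight u' + word_weight v') \<le> ?bound" for e' u' v'
    by (intro bexI[OF _ that(1)] exI[of _ u'] exI[of _ v'] conjI that(2,3))
  show ?case
  proof (cases "l = A")
    case True
    show ?thesis
    proof (rule result)
      show "grig_a \<circ> e \<in> {id, grig_a}" using e(1) gen_invol(1) by auto
      show "ev (l # w) = (grig_a \<circ> e) \<circ> tree_pair (ev u) (ev v)"
        using e(2) True by (simp add: comp_assoc)
      show "6 * (word_weight u + word_weight v) \<le> ?bound"
        using wt True by (simp split: if_splits)
    qed
  next
    case False
    obtain p r where pr: "gen l = tree_pair (ev p) (ev r)"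
      "6 * (word_weight p + word_weight r) \<le> 5 * weight l + 15"
    proof (cases l)
      case B then show ?thesis using that[of "[A]" "[C]"] gen_sections(1) by simp
    next
      case C then show ?thesis using that[of "[A]" "[D]"] gen_sections(2) by simp
    next
      case D then show ?thesis using that[of "[]" "[B]"] gen_sections(3) by simp
    qed (use False in simp)
    have "w = [] \<or> hd w = A" using Cons.prems False by (cases w) auto
    then have sum: "6 * (word_weight p + word_weight u + (word_weight r + word_weight v)) \<le> ?bound"
      using wt pr(2) False by auto
    consider "e = id" | "e = grig_a" using e(1) by blast
    then show ?thesis
    proof cases
      case 1
      show ?thesis
      proof (rule result[OF e(1)])
        show "ev (l # w) = e \<circ> tree_pair (ev (p @ u)) (ev (r @ v))"
          using 1 by (simp only: ev.simps e(2) pr(1) ev_append id_comp tree_pair_comp)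
        show "6 * (word_weight (p @ u) + word_weight (r @ v)) \<le> ?bound"
          using sum by simp
      qed
    next
      case 2
      show ?thesis
      proof (rule result[OF e(1)])
        have "ev (l # w) = tree_pair (ev p) (ev r) \<circ> grig_a \<circ> tree_pair (ev u) (ev v)"
          using 2 by (simp only: ev.simps e(2) pr(1) comp_assoc)
        then show "ev (l # w) = e \<circ> tree_pair (ev (r @ u)) (ev (p @ v))"
          using 2 by (simp only: a_swap[symmetric] comp_assoc ev_append tree_pair_comp)
        show "6 * (word_weight (r @ u) + word_weight (p @ v)) \<le> ?bound"
          using sum by simp
      qed
    qed
  qed
qed

definition grig_len :: "(bool list \<Rightarrow> bool list) \<Rightarrow> nat" where
  "grig_len g = (LEAST n. \<exists>w. ev w = g \<and> word_weight w = n)"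

lemma grig_len_le: "grig_len (ev w) \<le> word_weight w"
  unfolding grig_len_def by (rule Least_le) blast

lemma grig_len_attained:
  assumes "g \<in> carrier \<Gamma>"
  shows "\<exists>w. ev w = g \<and> word_weight w = grig_len g"
proof -
  from assms obtain w where "ev w = g" by (auto simp: carrier_Gamma)
  then show ?thesis
    unfolding grig_len_def by (intro LeastI[of "\<lambda>n. \<exists>w. ev w = g \<and> word_weight w = n"]) blast
qed

lemma grig_len_mult:
  assumes "g \<in> carrier \<Gamma>" "h \<in> carrier \<Gamma>"
  shows "grig_len (g \<circ> h) \<le> grig_len g + grig_len h"
proof -
  obtain u v where "ev u = g" "word_weight u = grig_len g" "ev v = h" "word_weight v = grig_len h"
    using assms grig_len_attained by metis
  then show ?thesis using grig_len_le[of "u @ v"] by (simp add: ev_append)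
qed

text \<open>All weights are positive, so a bound on the weight bounds the number of letters.\<close>

lemma finite_grig_balls: "finite {g \<in> carrier \<Gamma>. grig_len g \<le> n}"
proof -
  have len: "length w \<le> word_weight w" for w
  proof (induction w)
    case (Cons l w)
    then show ?case by (cases l) auto
  qed simp
  have "{g \<in> carrier \<Gamma>. grig_len g \<le> n} \<subseteq> ev ` {w. set w \<subseteq> UNIV \<and> length w \<le> n}"
  proof
    fix g assume "g \<in> {g \<in> carrier \<Gamma>. grig_len g \<le> n}"
    then obtain w where "ev w = g" "word_weight w \<le> n"
      using grig_len_attained[of g] by auto
    then show "g \<in> ev ` {w. set w \<subseteq> UNIV \<and> length w \<le> n}"
      using len[of w] by (intro image_eqI[of _ _ w]) simp_all
  qed
  moreover have "(UNIV :: letter set) = {A, B, C, D}" using letter.exhaust by blast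
  then have "finite (UNIV :: letter set)" by (metis finite.emptyI finite.insertI)
  then have "finite {w :: letter list. set w \<subseteq> UNIV \<and> length w \<le> n}"
    by (rule finite_lists_length_le)
  ultimately show ?thesis by (meson finite_imageI finite_subset)
qed

lemma grig_contraction:
  assumes "g \<in> carrier \<Gamma>"
  shows "\<exists>e\<in>{id, grig_a}. \<exists>g0\<in>carrier \<Gamma>. \<exists>g1\<in>carrier \<Gamma>. tree_pair g0 g1 \<in> carrier \<Gamma> \<and>
    g = e \<circ> tree_pair g0 g1 \<and> real (grig_len g0 + grig_len g1) \<le> 5 / 6 * grig_len g + 5 / 2"
proof -
  obtain w' where w': "ev w' = g" "word_weight w' = grig_len g"
    using grig_len_attained[OF assms] by blast
  obtain w where w: "alternating w" "ev w = g" "word_weight w \<le> grig_len g"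
    using alternating_representative[of w'] w' by metis
  obtain e u v where e: "e \<in> {id, grig_a}" "g = e \<circ> tree_pair (ev u) (ev v)"
    and "6 * (word_weight u + word_weight v)
      \<le> 5 * word_weight w + (if w = [] \<or> hd w = A then 0 else 15)"
    using alternating_sections[OF w(1)] w(2) by blast
  then have "6 * (word_weight u + word_weight v) \<le> 5 * grig_len g + 15"
    using w(3) by (auto split: if_splits)
  moreover have "grig_len (ev u) + grig_len (ev v) \<le> word_weight u + word_weight v"
    by (intro add_mono grig_len_le)
  ultimately have "6 * (grig_len (ev u) + grig_len (ev v)) \<le> 5 * grig_len g + 15"
    by (meson le_trans mult_le_mono2)
  then have "real (6 * (grig_len (ev u) + grig_len (ev v))) \<le> real (5 * grig_len g + 15)"
    by (simp only: of_nat_le_iff)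
  then have "real (grig_len (ev u) + grig_len (ev v)) \<le> 5 / 6 * grig_len g + 5 / 2"
    by simp
  moreover have "e \<circ> g = tree_pair (ev u) (ev v)"
    using e(1) unfolding e(2) by (elim insertE emptyE) (simp_all add: comp_cancel)
  then have "tree_pair (ev u) (ev v) \<in> carrier \<Gamma>"
    using e(1) assms comp_in_Gamma[of grig_a g] gen_in_Gamma(1)
    by (elim insertE emptyE) (simp_all only: id_comp)
  ultimately show ?thesis
    by (intro bexI[OF _ e(1)] bexI[OF _ ev_in_Gamma] conjI) (assumption, rule e(2), assumption)
qed

lemma contracting_branch_group_Grigorchuk:
  "contracting_branch_group grig_K \<Gamma> tree_pair grig_a grig_len (5 / 6) (5 / 2)"
proof (rule contracting_branch_group.intro[OF K_normal], unfold_locales)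
  show "tree_pair x y \<otimes>\<^bsub>\<Gamma>\<^esub> tree_pair x' y' = tree_pair (x \<otimes>\<^bsub>\<Gamma>\<^esub> x') (y \<otimes>\<^bsub>\<Gamma>\<^esub> y')" for x y x' y'
    by simp
  show "tree_pair \<one>\<^bsub>\<Gamma>\<^esub> \<one>\<^bsub>\<Gamma>\<^esub> = \<one>\<^bsub>\<Gamma>\<^esub>"
    by (simp add: tree_pair_id)
  show "grig_a \<otimes>\<^bsub>\<Gamma>\<^esub> tree_pair x y \<otimes>\<^bsub>\<Gamma>\<^esub> inv\<^bsub>\<Gamma>\<^esub> grig_a = tree_pair y x" for x y
    by (simp add: a_conj)
  show "\<exists>R. finite R \<and> R \<subseteq> carrier \<Gamma> \<and> (\<forall>g\<in>carrier \<Gamma>. \<exists>r\<in>R.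
      \<exists>n\<in>generate \<Gamma> {\<Gamma>.comm g k |g k. g \<in> carrier \<Gamma> \<and> k \<in> grig_K}. g = r \<otimes>\<^bsub>\<Gamma>\<^esub> n)"
    by (rule finite_index_mixed_commutators)
  show "\<exists>e\<in>{\<one>\<^bsub>\<Gamma>\<^esub>, grig_a}. \<exists>g0\<in>carrier \<Gamma>. \<exists>g1\<in>carrier \<Gamma>. tree_pair g0 g1 \<in> carrier \<Gamma> \<and>
      g = e \<otimes>\<^bsub>\<Gamma>\<^esub> tree_pair g0 g1 \<and>
      real (grig_len g0 + grig_len g1) \<le> 5 / 6 * grig_len g + 5 / 2"
    if "g \<in> carrier \<Gamma>" for g
    using grig_contraction[OF that] by simp
  show "grig_len (g \<otimes>\<^bsub>\<Gamma>\<^esub> h) \<le> grig_len g + grig_len h"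
    if "g \<in> carrier \<Gamma>" "h \<in> carrier \<Gamma>" for g h
    using grig_len_mult[OF that] by simp
  show "\<And>x y. x \<in> carrier \<Gamma> \<Longrightarrow> y \<in> carrier \<Gamma> \<Longrightarrow> tree_pair x y \<in> carrier \<Gamma> \<Longrightarrow>
      inv\<^bsub>\<Gamma>\<^esub> (tree_pair x y) = tree_pair (inv\<^bsub>\<Gamma>\<^esub> x) (inv\<^bsub>\<Gamma>\<^esub> y)"
    by (rule tree_pair_inv)
  show "\<And>x y. x \<in> grig_K \<Longrightarrow> y \<in> grig_K \<Longrightarrow> tree_pair x y \<in> grig_K"
    by (rule tree_pair_K)
  show "\<And>g. g \<in> carrier \<Gamma> \<Longrightarrow> \<exists>g'\<in>carrier \<Gamma>. tree_pair g g' \<in> carrier \<Gamma>"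
    by (rule tree_pair_lift)
  show "\<And>n. finite {g \<in> carrier \<Gamma>. grig_len g \<le> n}"
    by (rule finite_grig_balls)
  show "grig_a \<in> carrier \<Gamma>" by simp
  show "(5 / 6 :: real) < 1" by simp
qed

theorem theorem2:
  shows "\<exists>N::nat. \<forall>g \<in> derived Grigorchuk_group (carrier Grigorchuk_group).
           \<exists>cs. length cs \<le> N
             \<and> set cs \<subseteq> derived_set Grigorchuk_group (carrier Grigorchuk_group)
             \<and> g = foldr (\<otimes>\<^bsub>Grigorchuk_group\<^esub>) cs \<one>\<^bsub>Grigorchuk_group\<^esub>"
proof -
  from contracting_branch_group.finite_commutator_width[OF contracting_branch_group_Grigorchuk]
  obtain M where M:
    "\<forall>g\<in>derived \<Gamma> (carrier \<Gamma>). g \<in> prods \<Gamma> (derived_set \<Gamma> (carrier \<Gamma>)) M" ..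
  show ?thesis
  proof (intro exI[of _ M] ballI)
    fix g assume "g \<in> derived \<Gamma> (carrier \<Gamma>)"
    from prods_foldr[OF bspec[OF M this]]
    show "\<exists>cs. length cs \<le> M \<and> set cs \<subseteq> derived_set \<Gamma> (carrier \<Gamma>)
        \<and> g = foldr (\<otimes>\<^bsub>\<Gamma>\<^esub>) cs \<one>\<^bsub>\<Gamma>\<^esub>"
      by (elim exE conjE) (intro exI conjI, rule eq_refl)
  qed
qed

end
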